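(* Let $m,n\ge 1$ be integers and let $1\le q\le r<\infty$. Let $T$ be an operator taking $m$-tuples of functions on $\mathbb{R}^n$ to measurable functions on $\mathbb{R}^n$ (no linearity or sublinearity in the entries is required). Assume that $T$ is bounded from $L^{q}(\mathbb{R}^n)\times \cdots \times L^q(\mathbb{R}^n)$ ($m$ factors) to $L^{q/m,\infty}(\mathbb{R}^n)$ and that its multilinear grand maximal truncated operator $\mathcal M_T$ is bounded from $L^r(\mathbb{R}^n)\times \cdots \times L^r(\mathbb{R}^n)$ to $L^{r/m, \infty}(\mathbb{R}^n)$. Then there is a constant $c_{n,q,r}$, depending only on $n,q,r$ (and on the fixed number $m$), such that for all compactly supported functions $f_i\in L^r(\mathbb{R}^n)$, $i=1,\ldots, m$, there exists a sparse family $\mathcal S$ of cubes such that for a.e. $x\in \mathbb{R}^n$, $$|T(f_1,\ldots, f_m)(x)|\le c_{n,q,r}\big(\|T\|_{L^q\times\cdots\times L^q\rightarrow L^{q/m,\infty}}+ \|\mathcal M_T\|_{L^r\times \cdots\times L^r\rightarrow L^{r/m,\infty}}\big)\sum_{Q\in \mathcal S}\prod_{i=1}^m\Big( \frac1{|Q|}\int_Q |f_i|^r\Big)^{\frac 1r}\chi_Q(x).$$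
   Context: Cubes in $\mathbb{R}^n$ have sides parallel to the coordinate axes; for a cube $Q$ and $\lambda>0$, $\lambda Q$ is the cube with the same center and side length $\lambda\,\ell(Q)$; $\chi_E$ is the indicator function of $E$. Sparse family: a family $\mathcal S$ of cubes is sparse if there is $\gamma\in(0,1)$ such that for every $Q\in\mathcal S$ there is a measurable set $E_Q\subset Q$ with $|E_Q|\ge\gamma|Q|$, and the sets $\{E_Q\}_{Q\in\mathcal S}$ are pairwise disjoint. Multilinear grand maximal truncated operator: for $x\in\mathbb{R}^n$, $$\mathcal M_T (f_1,\ldots, f_m)(x)=\sup_{Q\ni x}\ \operatorname*{ess\,sup}_{\xi \in Q}\big|T(f_1,\ldots, f_m)(\xi)-T(f_1\chi_{3Q},\ldots, f_m\chi_{3Q})(\xi) \big|,$$ where the supremum is over all cubes $Q\subset\mathbb{R}^n$ containing $x$. Weak spaces: $\|g\|_{L^{s,\infty}}=\sup_{\lambda>0}\lambda\,|\{x:|g(x)|>\lambda\}|^{1/s}$ for $0<s<\infty$. An operator $U$ (linear or not) is bounded from $L^{s}\times\cdots\times L^{s}$ to $L^{s/m,\infty}$ if $\|U(f_1,\ldots,f_m)\|_{L^{s/m,\infty}}\le C\prod_{i=1}^m\|f_i\|_{L^s}$ for all $f_i\in L^s(\mathbb{R}^n)$; the least such $C$ is denoted $\|U\|_{L^s\times\cdots\times L^s\to L^{s/m,\infty}}$. *)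

theory Defs
  imports "HOL-Analysis.Analysis" "HOL-Probability.Essential_Supremum"
begin

text \<open>
  Scalar-valued functions take values in a type of class
  \<open>{real_normed_field, euclidean_space}\<close>, of which \<open>real\<close> and \<open>complex\<close> are instances.
  An \<open>m\<close>-tuple of functions is a function on a finite index type \<open>'m\<close> with \<open>m = CARD('m)\<close>.
  All measure theory is with respect to Lebesgue measure.
\<close>

text \<open>
  Cubes are taken open and nondegenerate. Boundaries of cubes are null sets, and with open cubes
  the superlevel sets of the maximal operator below are open, so their measure makes sense.
\<close>

definition cube :: "real ^ 'n \<Rightarrow> real \<Rightarrow> (real ^ 'n) set" where
  "cube c l = {x. \<forall>i. \<bar>x $ i - c $ i\<bar> < l / 2}"

definition is_cube :: "(real ^ 'n) set \<Rightarrow> bool" where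
  "is_cube Q \<longleftrightarrow> (\<exists>c l. 0 < l \<and> Q = cube c l)"

definition sparse_family :: "(real ^ 'n) set set \<Rightarrow> bool" where
  "sparse_family S \<longleftrightarrow> (\<forall>Q\<in>S. is_cube Q) \<and>
     (\<exists>\<gamma>. 0 < \<gamma> \<and> \<gamma> < 1 \<and>
       (\<exists>E. (\<forall>Q\<in>S. E Q \<in> sets lebesgue \<and> E Q \<subseteq> Q \<and>
                     measure lebesgue (E Q) \<ge> \<gamma> * measure lebesgue Q) \<and>
            disjoint_family_on E S))"

definition Lp :: "real \<Rightarrow> (real ^ 'n \<Rightarrow> 'b::euclidean_space) set" where
  "Lp p = {f \<in> borel_measurable lebesgue. integrable lebesgue (\<lambda>x. norm (f x) powr p)}"

definition Lp_norm :: "real \<Rightarrow> (real ^ 'n \<Rightarrow> 'b::euclidean_space) \<Rightarrow> real" where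
  "Lp_norm p f = (LINT x|lebesgue. norm (f x) powr p) powr (1 / p)"

definition compactly_supported :: "(real ^ 'n \<Rightarrow> 'b::euclidean_space) \<Rightarrow> bool" where
  "compactly_supported f \<longleftrightarrow> compact (closure {x. f x \<noteq> 0})"

text \<open>Only used for positive exponents, where it is the usual power on \<open>[0, \<infinity>]\<close>.\<close>

definition ennreal_powr :: "ennreal \<Rightarrow> real \<Rightarrow> ennreal" where
  "ennreal_powr t a = (if t = \<infinity> then \<infinity> else ennreal (enn2real t powr a))"

text \<open>
  The weak quasinorm is stated for \<open>[0, \<infinity>]\<close>-valued functions, since the maximal operator may
  be infinite; a scalar-valued function \<open>g\<close> enters through \<open>\<lambda>x. ennreal (norm (g x))\<close>.
\<close>

definition weak_norm :: "real \<Rightarrow> (real ^ 'n \<Rightarrow> ennreal) \<Rightarrow> ennreal" where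
  "weak_norm s g =
     (SUP t\<in>{0<..}. ennreal t * ennreal_powr (emeasure lebesgue {x. g x > ennreal t}) (1 / s))"

definition weak_type_const ::
  "real \<Rightarrow> (('m::finite \<Rightarrow> real ^ 'n \<Rightarrow> 'b::euclidean_space) \<Rightarrow> real ^ 'n \<Rightarrow> ennreal) \<Rightarrow> real \<Rightarrow> bool"
where
  "weak_type_const s U C \<longleftrightarrow> 0 \<le> C \<and>
     (\<forall>f. (\<forall>i. f i \<in> Lp s) \<longrightarrow>
        weak_norm (s / real CARD('m)) (U f) \<le> ennreal (C * (\<Prod>i\<in>UNIV. Lp_norm s (f i))))"

definition weak_bounded ::
  "real \<Rightarrow> (('m::finite \<Rightarrow> real ^ 'n \<Rightarrow> 'b::euclidean_space) \<Rightarrow> real ^ 'n \<Rightarrow> ennreal) \<Rightarrow> bool"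
where
  "weak_bounded s U \<longleftrightarrow> (\<exists>C. weak_type_const s U C)"

text \<open>
  The admissible constants form a closed subset of \<open>[0, \<infinity>)\<close>, so for a bounded operator this
  infimum is attained and is the least admissible constant.
\<close>

definition weak_op_norm ::
  "real \<Rightarrow> (('m::finite \<Rightarrow> real ^ 'n \<Rightarrow> 'b::euclidean_space) \<Rightarrow> real ^ 'n \<Rightarrow> ennreal) \<Rightarrow> real"
where
  "weak_op_norm s U = Inf {C. weak_type_const s U C}"

definition abs_op ::
  "(('m \<Rightarrow> real ^ 'n \<Rightarrow> 'b::euclidean_space) \<Rightarrow> real ^ 'n \<Rightarrow> 'b)
     \<Rightarrow> ('m \<Rightarrow> real ^ 'n \<Rightarrow> 'b) \<Rightarrow> real ^ 'n \<Rightarrow> ennreal" where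
  "abs_op T f x = ennreal (norm (T f x))"

definition restrict_tuple ::
  "(real ^ 'n) set \<Rightarrow> ('m \<Rightarrow> real ^ 'n \<Rightarrow> 'b::euclidean_space) \<Rightarrow> 'm \<Rightarrow> real ^ 'n \<Rightarrow> 'b" where
  "restrict_tuple A f = (\<lambda>i y. indicator A y *\<^sub>R f i y)"

definition grand_maximal ::
  "(('m \<Rightarrow> real ^ 'n \<Rightarrow> 'b::euclidean_space) \<Rightarrow> real ^ 'n \<Rightarrow> 'b)
     \<Rightarrow> ('m \<Rightarrow> real ^ 'n \<Rightarrow> 'b) \<Rightarrow> real ^ 'n \<Rightarrow> ennreal" where
  "grand_maximal T f x =
     (SUP (c, l) \<in> {(c, l). 0 < l \<and> x \<in> cube c l}.
        esssup (lebesgue_on (cube c l))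
          (\<lambda>\<xi>. ennreal (norm (T f \<xi> - T (restrict_tuple (cube c (3 * l)) f) \<xi>))))"

definition Lp_average :: "real \<Rightarrow> (real ^ 'n \<Rightarrow> 'b::euclidean_space) \<Rightarrow> (real ^ 'n) set \<Rightarrow> real" where
  "Lp_average r f Q =
     (1 / measure lebesgue Q * (LINT x:Q|lebesgue. norm (f x) powr r)) powr (1 / r)"

end

theory Submission
  imports Defs "HOL-Library.Sublist"
begin

text \<open>
  Write \<open>3p\<close> for the cube concentric with \<open>p\<close> and three times as wide, and \<open>f\<chi>\<close> for the tuple of the
  functions \<open>f i * \<chi>\<close>. The theorem follows by iterating one comparison on a single cube \<open>p\<close>
  (\<open>local_domination\<close>). By the two weak type bounds, both \<open>|T(f\<chi>\<^bsub>3p\<^esub>)|\<close> and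
  \<open>M\<^sub>T(f\<chi>\<^bsub>3p\<^esub>)\<close> are at most \<open>K\<close> times the respective operator norm times the product of the averages
  \<open>\<langle>f i\<rangle>\<close> with exponent \<open>r\<close> over \<open>3p\<close>, except on a set whose measure is a small fraction of \<open>|p|\<close> once \<open>K\<close> is large.
  The bound for \<open>T\<close> first involves \<open>q\<close>-averages, which Jensen's inequality dominates by the
  \<open>r\<close>-averages. Inside \<open>p\<close> the exceptional set is almost covered by disjoint subcubes \<open>u\<close> of total
  measure at most \<open>|p| / 2\<close>, none of which it contains (\<open>stopping_cubes\<close>). Off these subcubes the
  bound for \<open>T(f\<chi>\<^bsub>3p\<^esub>)\<close> is immediate. Each \<open>u\<close> has a point at which \<open>M\<^sub>T(f\<chi>\<^bsub>3p\<^esub>)\<close> is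
  small, and the definition of \<open>M\<^sub>T\<close> then says that \<open>T(f\<chi>\<^bsub>3p\<^esub>)\<close> and \<open>T(f\<chi>\<^bsub>3u\<^esub>)\<close> differ on \<open>u\<close>
  by at most a bound of the same form almost everywhere. This comparison is what allows one to
  pass from \<open>p\<close> to \<open>u\<close>.

  Repeating the step inside each \<open>u\<close> yields a tree of cubes in which the children of a cube fill at
  most half of it. The parts of the cubes outside their children are therefore disjoint and large,
  which gives sparseness, and almost every point leaves the tree after finitely many generations,
  so that the bounds collected along its branch add up to the sparse sum (locale
  \<open>stopping_tree\<close>). The tree starts from disjoint cubes \<open>p\<close> that cover almost all of space
  and whose triples all contain the supports of the \<open>f i\<close> (\<open>shell_cubes\<close>), so that \<open>T(f\<chi>\<^bsub>3p\<^esub>) = T f\<close>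
  on each of them. The sparse family consists of the triples of all cubes in the tree; tripling
  costs a factor \<open>3^n\<close> in the sparseness constant.
\<close>

section \<open>Trees of nested sets with geometric decay\<close>

lemma emeasure_UN_le_cmult:
  assumes "countable I"
    and "disjoint_family_on A I" "\<And>i. i \<in> I \<Longrightarrow> A i \<in> sets M"
    and "disjoint_family_on B I" "\<And>i. i \<in> I \<Longrightarrow> B i \<in> sets M"
    and le: "\<And>i. i \<in> I \<Longrightarrow> emeasure M (A i) \<le> c * emeasure M (B i)"
  shows "emeasure M (\<Union>(A ` I)) \<le> c * emeasure M (\<Union>(B ` I))"
proof -
  have "emeasure M (\<Union>(A ` I)) = (\<integral>\<^sup>+i. emeasure M (A i) \<partial>count_space I)"
    using assms by (intro emeasure_UN_countable) auto
  also have "\<dots> \<le> (\<integral>\<^sup>+i. c * emeasure M (B i) \<partial>count_space I)"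
    using le by (intro nn_integral_mono) auto
  also have "\<dots> = c * (\<integral>\<^sup>+i. emeasure M (B i) \<partial>count_space I)"
    by (intro nn_integral_cmult) auto
  also have "\<dots> = c * emeasure M (\<Union>(B ` I))"
    using assms by (subst emeasure_UN_countable) auto
  finally show ?thesis .
qed

primrec generation :: "('i \<Rightarrow> 'i set) \<Rightarrow> 'i set \<Rightarrow> nat \<Rightarrow> 'i set" where
  "generation N R 0 = R"
| "generation N R (Suc k) = (\<Union>p\<in>generation N R k. N p)"

text \<open>
  The index type stands for cubes, \<open>X p\<close> is the point set of \<open>p\<close> and \<open>N p\<close> the family chosen inside
  it, its children.
  The set \<open>I\<close> of admissible indices is separate from the roots because the choice \<open>N\<close> is made for
  every admissible cube before the tree is known.
\<close>

locale stopping_tree =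
  fixes M :: "'a measure" and X :: "'i \<Rightarrow> 'a set" and N :: "'i \<Rightarrow> 'i set"
    and R I :: "'i set"
  assumes roots: "R \<subseteq> I" "countable R" "disjoint_family_on X R"
    and X_sets: "p \<in> I \<Longrightarrow> X p \<in> sets M"
    and X_pos: "p \<in> I \<Longrightarrow> 0 < emeasure M (X p)"
    and X_fin: "p \<in> I \<Longrightarrow> emeasure M (X p) < \<infinity>"
    and N_closed: "p \<in> I \<Longrightarrow> N p \<subseteq> I"
    and N_countable: "p \<in> I \<Longrightarrow> countable (N p)"
    and N_disjoint: "p \<in> I \<Longrightarrow> disjoint_family_on X (N p)"
    and N_sub: "p \<in> I \<Longrightarrow> u \<in> N p \<Longrightarrow> X u \<subseteq> X p"
    and N_half: "p \<in> I \<Longrightarrow> emeasure M (\<Union>(X ` N p)) \<le> ennreal (1/2) * emeasure M (X p)"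
begin

abbreviation gen :: "nat \<Rightarrow> 'i set" where "gen \<equiv> generation N R"

definition tree :: "'i set" where "tree = (\<Union>k. gen k)"

definition core :: "'i \<Rightarrow> 'a set" where "core p = X p - \<Union>(X ` N p)"

lemma gen_sub: "gen k \<subseteq> I"
  by (induction k) (use roots N_closed in auto)

lemma gen_countable: "countable (gen k)"
proof (induction k)
  case (Suc k)
  then show ?case using N_countable gen_sub[of k] by (simp, blast intro!: countable_UN)
qed (use roots in simp)

lemma gen_disjoint: "disjoint_family_on X (gen k)"
proof (induction k)
  case 0
  then show ?case using roots by simp
next
  case (Suc k)
  show ?case
    unfolding disjoint_family_on_def
  proof (intro ballI impI)
    fix p p' assume "p \<in> gen (Suc k)" "p' \<in> gen (Suc k)" and ne: "p \<noteq> p'"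
    then obtain u u' where u: "u \<in> gen k" "p \<in> N u" "u' \<in> gen k" "p' \<in> N u'" by auto
    then have I: "u \<in> I" "u' \<in> I" using gen_sub by auto
    show "X p \<inter> X p' = {}"
    proof (cases "u = u'")
      case True
      then show ?thesis using u ne N_disjoint[OF I(1)] by (auto simp: disjoint_family_on_def)
    next
      case False
      then have "X u \<inter> X u' = {}" using Suc u by (auto simp: disjoint_family_on_def)
      then show ?thesis using N_sub[OF I(1) u(2)] N_sub[OF I(2) u(4)] by blast
    qed
  qed
qed

lemma gen_ancestor:
  assumes "q \<in> gen (Suc (j + d))"
  shows "\<exists>p\<in>gen j. \<exists>u\<in>N p. X q \<subseteq> X u"
  using assms
proof (induction d arbitrary: q)
  case 0
  then show ?case by auto
next
  case (Suc d)
  then obtain w where w: "w \<in> gen (Suc (j + d))" "q \<in> N w" by auto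
  then have "X q \<subseteq> X w" using N_sub gen_sub by blast
  then show ?case using Suc.IH[OF w(1)] by blast
qed

text \<open>
  A repeated index would lie inside one of its own children and so have at most half of its own
  positive finite measure. Without this, an index could be charged twice along a branch in
  \<open>tree_domination\<close>.
\<close>

lemma gen_unique:
  assumes "p \<in> gen j" "p \<in> gen k"
  shows "j = k"
proof -
  have False if p: "p \<in> gen j" "p \<in> gen k" and "j < k" for j k
  proof -
    obtain d where "k = Suc (j + d)" using \<open>j < k\<close> less_imp_Suc_add by blast
    with gen_ancestor p(2) obtain w u where w: "w \<in> gen j" "u \<in> N w" "X p \<subseteq> X u" by blast
    have I: "p \<in> I" "w \<in> I" using w(1) p gen_sub by auto
    have "X p \<noteq> {}" using X_pos[OF I(1)] by auto
    moreover have "X p \<subseteq> X w" using w N_sub I by blast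
    ultimately have "w = p"
      using gen_disjoint[of j] w(1) p(1) unfolding disjoint_family_on_def by blast
    then have "emeasure M (X p) \<le> emeasure M (\<Union>(X ` N p))"
      using w N_countable[OF I(1)] N_closed[OF I(1)] X_sets
      by (intro emeasure_mono sets.countable_UN') auto
    also have "\<dots> \<le> ennreal (1/2) * emeasure M (X p)" using N_half[OF I(1)] .
    finally have le: "emeasure M (X p) \<le> ennreal (1/2) * emeasure M (X p)" .
    obtain a where "emeasure M (X p) = ennreal a" "0 \<le> a"
      using X_fin[OF I(1)] by (cases "emeasure M (X p)") auto
    then show False using le X_pos[OF I(1)] by (simp add: ennreal_mult'[symmetric] del: ennreal_half)
  qed
  then show ?thesis using assms by (metis nat_neq_iff)
qed

lemma tree_sub: "tree \<subseteq> I"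
  using gen_sub by (auto simp: tree_def)

lemma tree_countable: "countable tree"
  using gen_countable by (auto simp: tree_def)

lemma core_sets: "p \<in> I \<Longrightarrow> core p \<in> sets M"
  unfolding core_def using X_sets N_closed N_countable
  by (intro sets.Diff sets.countable_UN') auto

text \<open>
  Of two cubes from different generations, the younger one lies in a child of some cube of the older
  generation. That cube is either the older cube itself, whose core avoids its children, or
  disjoint from it.
\<close>

lemma core_disjoint: "disjoint_family_on core tree"
proof -
  have key: "core p \<inter> core q = {}" if "p \<in> gen j" "q \<in> gen k" "j < k" for p q j k
  proof -
    obtain d where "k = Suc (j + d)" using \<open>j < k\<close> less_imp_Suc_add by blast
    with gen_ancestor that(2) obtain w u where w: "w \<in> gen j" "u \<in> N w" "X q \<subseteq> X u" by blast
    show ?thesis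
    proof (cases "w = p")
      case True
      then show ?thesis using w by (auto simp: core_def)
    next
      case False
      then have "X w \<inter> X p = {}" using gen_disjoint[of j] w(1) that(1)
        by (auto simp: disjoint_family_on_def)
      moreover have "X q \<subseteq> X w" using w N_sub gen_sub by blast
      ultimately show ?thesis by (auto simp: core_def)
    qed
  qed
  have key0: "core p \<inter> core q = {}" if "p \<in> gen j" "q \<in> gen j" "p \<noteq> q" for p q j
    using gen_disjoint[of j] that by (auto simp: disjoint_family_on_def core_def)
  show ?thesis
    unfolding disjoint_family_on_def tree_def
  proof (intro ballI impI)
    fix p q assume "p \<in> (\<Union>k. gen k)" "q \<in> (\<Union>k. gen k)" and ne: "p \<noteq> q"
    then obtain j k where jk: "p \<in> gen j" "q \<in> gen k" by auto
    consider "j < k" | "k < j" | "j = k" by linarith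
    then show "core p \<inter> core q = {}"
    proof cases
      case 1
      then show ?thesis using key[OF jk] by simp
    next
      case 2
      then show ?thesis using key[OF jk(2,1)] by blast
    next
      case 3
      then show ?thesis using key0 jk ne by auto
    qed
  qed
qed

lemma core_large:
  assumes "p \<in> I"
  shows "emeasure M (X p) \<le> 2 * emeasure M (core p)"
proof -
  let ?V = "\<Union>(X ` N p)"
  have V: "?V \<in> sets M" using X_sets N_closed N_countable assms by (intro sets.countable_UN') auto
  have eq: "emeasure M (X p) = emeasure M (core p) + emeasure M ?V"
  proof -
    have "X p = core p \<union> ?V" using N_sub[OF assms] by (auto simp: core_def)
    then show ?thesis
      using plus_emeasure[OF core_sets[OF assms] V] unfolding core_def by (metis Diff_disjoint inf_commute)
  qed
  obtain a where a: "emeasure M (core p) = ennreal a" "0 \<le> a"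
    using X_fin[OF assms] eq by (cases "emeasure M (core p)") auto
  obtain b where b: "emeasure M ?V = ennreal b" "0 \<le> b"
    using X_fin[OF assms] eq by (cases "emeasure M ?V") auto
  have "b \<le> 1/2 * (a + b)"
    using N_half[OF assms] a b unfolding eq
    by (simp del: ennreal_half ennreal_plus add: ennreal_plus[symmetric] ennreal_mult'[symmetric])
  then have "ennreal (a + b) \<le> ennreal (2 * a)" by (intro ennreal_leI) auto
  then show ?thesis
    using a b eq by (simp add: ennreal_mult)
qed

text \<open>
  Inside one root, each generation fills at most half of what the previous one fills, so the points
  that survive in all generations form a null set. Restricting to one root keeps the measures
  finite although infinitely many roots may cover the whole space.
\<close>

lemma gen_vanish:
  "AE x in M. \<forall>r\<in>R. x \<in> X r \<longrightarrow> (\<exists>k. x \<notin> \<Union>(X ` gen k))"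
proof (intro AE_ball_countable' roots(2))
  fix r assume r: "r \<in> R"
  then have rI: "r \<in> I" using roots by auto
  define V where "V k = (\<Union>p\<in>gen k. X p \<inter> X r)" for k
  have Vs: "V k \<in> sets M" for k
    unfolding V_def using gen_countable gen_sub X_sets rI
    by (intro sets.countable_UN') (auto intro!: sets.Int)
  have step: "emeasure M (V (Suc k)) \<le> ennreal (1/2) * emeasure M (V k)" for k
  proof -
    have "V (Suc k) = (\<Union>p\<in>gen k. \<Union>(X ` N p) \<inter> X r)" unfolding V_def by auto
    moreover have "emeasure M (\<Union>p\<in>gen k. \<Union>(X ` N p) \<inter> X r)
        \<le> ennreal (1/2) * emeasure M (\<Union>p\<in>gen k. X p \<inter> X r)"
    proof (rule emeasure_UN_le_cmult[OF gen_countable])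
      show "disjoint_family_on (\<lambda>p. X p \<inter> X r) (gen k)"
        using gen_disjoint[of k] by (auto simp: disjoint_family_on_def)
      show "disjoint_family_on (\<lambda>p. \<Union>(X ` N p) \<inter> X r) (gen k)"
        unfolding disjoint_family_on_def
      proof (intro ballI impI)
        fix p q assume pq: "p \<in> gen k" "q \<in> gen k" "p \<noteq> q"
        then have "X p \<inter> X q = {}" using gen_disjoint[of k] by (auto simp: disjoint_family_on_def)
        moreover have "\<Union>(X ` N p) \<subseteq> X p" "\<Union>(X ` N q) \<subseteq> X q"
          using N_sub gen_sub pq by blast+
        ultimately show "\<Union>(X ` N p) \<inter> X r \<inter> (\<Union>(X ` N q) \<inter> X r) = {}" by blast
      qed
      fix p assume p: "p \<in> gen k"
      then have pI: "p \<in> I" using gen_sub by auto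
      show "X p \<inter> X r \<in> sets M" using X_sets pI rI by auto
      show "\<Union>(X ` N p) \<inter> X r \<in> sets M"
        using X_sets N_closed N_countable pI rI by (intro sets.Int sets.countable_UN') auto
      have "X p \<subseteq> X r \<or> X p \<inter> X r = {}"
      proof (cases k)
        case 0
        then show ?thesis using p r roots(3) unfolding disjoint_family_on_def
          by (cases "p = r") auto
      next
        case (Suc d)
        then obtain w u where w: "w \<in> R" "u \<in> N w" "X p \<subseteq> X u"
          using gen_ancestor[of p 0 d] p by auto
        then have "X p \<subseteq> X w" using N_sub roots by blast
        then show ?thesis using roots(3) w(1) r unfolding disjoint_family_on_def
          by (cases "w = r") blast+
      qed
      then show "emeasure M (\<Union>(X ` N p) \<inter> X r) \<le> ennreal (1/2) * emeasure M (X p \<inter> X r)"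
      proof
        assume "X p \<subseteq> X r"
        moreover from this have "\<Union>(X ` N p) \<subseteq> X r" using N_sub[OF pI] by blast
        ultimately show ?thesis using N_half[OF pI] by (simp add: Int_absorb2)
      next
        assume "X p \<inter> X r = {}"
        moreover from this have "\<Union>(X ` N p) \<inter> X r = {}" using N_sub[OF pI] by blast
        ultimately show ?thesis by (metis emeasure_empty zero_le)
      qed
    qed
    ultimately show ?thesis by (simp add: V_def)
  qed
  obtain a where a: "emeasure M (X r) = ennreal a" "0 \<le> a"
    using X_fin[OF rI] by (cases "emeasure M (X r)") auto
  have bound: "emeasure M (V k) \<le> ennreal ((1/2)^k * a)" for k
  proof (induction k)
    case 0
    have "V 0 \<subseteq> X r" by (auto simp: V_def)
    then show ?case using emeasure_mono[of "V 0" "X r" M] X_sets[OF rI] a by simp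
  next
    case (Suc k)
    have "emeasure M (V (Suc k)) \<le> ennreal (1/2) * ennreal ((1/2)^k * a)"
      using step[of k] Suc by (meson mult_left_mono order_trans zero_le)
    also have "\<dots> = ennreal ((1/2)^Suc k * a)"
      using a(2) by (simp add: ennreal_mult'[symmetric] mult.assoc del: ennreal_half)
    finally show ?case .
  qed
  define Z where "Z = (\<Inter>k. V k)"
  have Zs: "Z \<in> sets M" unfolding Z_def using Vs by auto
  have "emeasure M Z \<le> ennreal ((1/2)^k * a)" for k
    using emeasure_mono[of Z "V k" M] Vs[of k] bound[of k] by (auto simp: Z_def intro: order_trans)
  moreover have "(\<lambda>k. ennreal ((1/2)^k * a)) \<longlonglongrightarrow> ennreal (0 * a)"
    by (intro tendsto_ennrealI tendsto_mult LIMSEQ_power_zero tendsto_const) auto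
  ultimately have "emeasure M Z \<le> ennreal (0 * a)"
    by (intro LIMSEQ_le_const) auto
  then have "Z \<in> null_sets M" using Zs by (auto simp: null_sets_def)
  then have "AE x in M. x \<notin> Z" by (rule AE_not_in)
  then show "AE x in M. x \<in> X r \<longrightarrow> (\<exists>k. x \<notin> \<Union>(X ` gen k))"
    by (rule AE_mp) (auto simp: Z_def V_def)
qed

text \<open>
  Starting from a root, each step at a point \<open>x\<close> either stops, when \<open>x\<close> is in the core, or pays \<open>a p\<close> and
  moves to the child containing \<open>x\<close>. By \<open>gen_vanish\<close> the walk ends, and \<open>B\<close> collects the cubes that it
  has visited.
\<close>

lemma tree_domination:
  fixes t :: "'i \<Rightarrow> 'a \<Rightarrow> ennreal" and a :: "'i \<Rightarrow> ennreal"
  assumes stop: "\<And>p. p \<in> I \<Longrightarrow> AE x in M. x \<in> core p \<longrightarrow> t p x \<le> a p"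
    and continue: "\<And>p u. p \<in> I \<Longrightarrow> u \<in> N p \<Longrightarrow> AE x in M. x \<in> X u \<longrightarrow> t p x \<le> a p + t u x"
  shows "AE x in M. \<forall>r\<in>R. x \<in> X r \<longrightarrow>
    (\<exists>B. finite B \<and> B \<subseteq> tree \<and> (\<forall>p\<in>B. x \<in> X p) \<and> t r x \<le> (\<Sum>p\<in>B. a p))"
proof -
  have 1: "AE x in M. \<forall>p\<in>tree. x \<in> core p \<longrightarrow> t p x \<le> a p"
    using stop tree_sub by (intro AE_ball_countable' tree_countable) auto
  have 2: "AE x in M. \<forall>p\<in>tree. \<forall>u\<in>N p. x \<in> X u \<longrightarrow> t p x \<le> a p + t u x"
    using continue tree_sub N_countable by (intro AE_ball_countable' tree_countable) auto
  show ?thesis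
    using 1 2 gen_vanish
  proof eventually_elim
    case (elim x)
    show ?case
    proof (intro ballI impI)
      fix r assume r: "r \<in> R" "x \<in> X r"
      let ?done = "\<lambda>B. t r x \<le> (\<Sum>p\<in>B. a p)"
      \<comment> \<open>Invariant of the walk: it has stopped, or it has reached a cube of generation \<open>k\<close>.\<close>
      have "\<exists>B. finite B \<and> B \<subseteq> (\<Union>j<k. gen j) \<and> (\<forall>p\<in>B. x \<in> X p) \<and>
              (?done B \<or> (\<exists>p\<in>gen k. x \<in> X p \<and> t r x \<le> (\<Sum>p\<in>B. a p) + t p x))" for k
      proof (induction k)
        case 0
        show ?case using r by (intro exI[of _ "{}"]) auto
      next
        case (Suc k)
        then obtain B where B: "finite B" "B \<subseteq> (\<Union>j<k. gen j)" "\<forall>p\<in>B. x \<in> X p"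
          and alt: "?done B \<or> (\<exists>p\<in>gen k. x \<in> X p \<and> t r x \<le> (\<Sum>p\<in>B. a p) + t p x)" by blast
        from alt show ?case
        proof
          assume "?done B"
          moreover have "B \<subseteq> (\<Union>j<Suc k. gen j)" using B(2) unfolding lessThan_Suc by blast
          ultimately show ?thesis using B \<open>?done B\<close> by (intro exI[of _ B]) simp
        next
          assume "\<exists>p\<in>gen k. x \<in> X p \<and> t r x \<le> (\<Sum>p\<in>B. a p) + t p x"
          then obtain p where p: "p \<in> gen k" "x \<in> X p" "t r x \<le> (\<Sum>p\<in>B. a p) + t p x" by blast
          have "p \<notin> B" using B(2) gen_unique[OF p(1)] by blast
          then have sum: "(\<Sum>p\<in>insert p B. a p) = (\<Sum>p\<in>B. a p) + a p"
            using B(1) by (simp add: add.commute)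
          have pt: "p \<in> tree" using p(1) by (auto simp: tree_def)
          have B': "finite (insert p B)" "insert p B \<subseteq> (\<Union>j<Suc k. gen j)" "\<forall>p\<in>insert p B. x \<in> X p"
            using B p unfolding lessThan_Suc by blast+
          show ?thesis
          proof (cases "x \<in> core p")
            case True
            then have "t p x \<le> a p" using elim(1) pt by blast
            then have "?done (insert p B)"
              unfolding sum using p(3) by (meson add_left_mono order_trans)
            then show ?thesis using B' by (intro exI[of _ "insert p B"]) simp
          next
            case False
            then obtain u where u: "u \<in> N p" "x \<in> X u" using p(2) by (auto simp: core_def)
            then have "t p x \<le> a p + t u x" using elim(2) pt by blast
            then have "t r x \<le> (\<Sum>p\<in>insert p B. a p) + t u x"
              unfolding sum using p(3) by (metis add.assoc add_left_mono order_trans)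
            moreover have "u \<in> gen (Suc k)" using u p by auto
            ultimately show ?thesis
              using B' u(2) by (intro exI[of _ "insert p B"] conjI disjI2 bexI[of _ u]) auto
          qed
        qed
      qed
      moreover obtain k where k: "x \<notin> \<Union>(X ` gen k)" using elim(3) r by blast
      ultimately obtain B where B: "finite B" "B \<subseteq> (\<Union>j<k. gen j)" "\<forall>p\<in>B. x \<in> X p"
        and alt: "?done B \<or> (\<exists>p\<in>gen k. x \<in> X p \<and> t r x \<le> (\<Sum>p\<in>B. a p) + t p x)"
        by meson
      have "?done B" using alt k by auto
      moreover have "B \<subseteq> tree" using B(2) unfolding tree_def by blast
      ultimately show "\<exists>B. finite B \<and> B \<subseteq> tree \<and> (\<forall>p\<in>B. x \<in> X p) \<and> t r x \<le> (\<Sum>p\<in>B. a p)"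
        using B by (intro exI[of _ B]) simp
    qed
  qed
qed

end

section \<open>Cubes and their triadic children\<close>

text \<open>
  Families of cubes are indexed by pairs of centre and side, so that tripling and subdividing are
  operations on indices.
\<close>

abbreviation cub :: "(real ^ 'n::finite) \<times> real \<Rightarrow> (real ^ 'n) set" where
  "cub p \<equiv> cube (fst p) (snd p)"

definition triple :: "(real ^ 'n::finite) \<times> real \<Rightarrow> (real ^ 'n) \<times> real" where
  "triple p = (fst p, 3 * snd p)"

text \<open>
  The \<open>3^n\<close> positions of a triadic subcube relative to the centre of its parent. Dividing by three
  rather than two keeps the centre: the digit \<open>0\<close> gives the concentric child, which is what makes
  the shells of \<open>shell_cubes\<close> unions of children.
\<close>

definition digits :: "(real ^ 'n::finite) set" where
  "digits = {v. \<forall>i. v $ i \<in> {-1, 0, 1}}"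

definition child :: "real ^ 'n::finite \<Rightarrow> (real ^ 'n) \<times> real \<Rightarrow> (real ^ 'n) \<times> real" where
  "child v p = (fst p + (snd p / 3) *\<^sub>R v, snd p / 3)"

lemma triple_simps [simp]: "fst (triple p) = fst p" "snd (triple p) = 3 * snd p"
  by (simp_all add: triple_def)

lemma child_simps [simp]: "fst (child v p) = fst p + (snd p / 3) *\<^sub>R v" "snd (child v p) = snd p / 3"
  by (simp_all add: child_def)

lemma cube_eq_box:
  fixes c :: "real ^ 'n::finite"
  shows "cube c l = box (c - (l/2) *\<^sub>R 1) (c + (l/2) *\<^sub>R 1)"
proof -
  have "\<bar>x $ i - c $ i\<bar> < l / 2 \<longleftrightarrow> c $ i - l / 2 < x $ i \<and> x $ i < c $ i + l / 2" for x i
    by arith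
  then show ?thesis by (simp add: cube_def set_eq_iff mem_box_cart)
qed

lemma open_cube: "open (cube c l)"
  by (simp add: cube_eq_box open_box)

lemma cube_sets [simp, measurable]: "cube c l \<in> sets lebesgue"
  by (simp add: cube_eq_box)

lemma emeasure_cube:
  fixes c :: "real ^ 'n::finite"
  assumes "0 < l"
  shows "emeasure lebesgue (cube c l) = ennreal (l ^ CARD('n))"
proof -
  have one: "(1 :: real ^ 'n) \<bullet> b = 1" if "b \<in> Basis" for b
    using that by (auto simp: Basis_vec_def inner_axis)
  have width: "c + (l/2) *\<^sub>R 1 - (c - (l/2) *\<^sub>R 1) = l *\<^sub>R 1"
    by (simp add: vec_eq_iff)
  have "emeasure lebesgue (cube c l) = (\<Prod>b\<in>(Basis :: (real ^ 'n) set). l)"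
    unfolding cube_eq_box using assms one
    by (simp add: width inner_diff_left inner_add_left)
  then show ?thesis by simp
qed

lemma measure_cube:
  fixes c :: "real ^ 'n::finite"
  assumes "0 < l"
  shows "measure lebesgue (cube c l) = l ^ CARD('n)"
  using emeasure_cube[OF assms, of c] assms by (simp add: measure_def)

lemma cube_inject:
  assumes "0 < l" "0 < l'" "cube c l = cube c' l'"
  shows "c = c'" "l = (l'::real)"
proof -
  have ne: "cube c l \<noteq> {}" using assms(1) by (auto simp: cube_def intro!: exI[of _ c])
  have *: "c - (l/2) *\<^sub>R 1 = c' - (l'/2) *\<^sub>R 1 \<and> c + (l/2) *\<^sub>R 1 = c' + (l'/2) *\<^sub>R 1"
    using assms(3) ne unfolding cube_eq_box eq_box by blast
  have box: "(c - (l/2) *\<^sub>R 1) $ i = (c' - (l'/2) *\<^sub>R 1) $ i \<and> (c + (l/2) *\<^sub>R 1) $ i = (c' + (l'/2) *\<^sub>R 1) $ i" for i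
    using * by simp
  then have coord: "c $ i = c' $ i \<and> l = l'" for i
  proof -
    have "c $ i - l / 2 = c' $ i - l' / 2" "c $ i + l / 2 = c' $ i + l' / 2"
      using box[of i] by simp_all
    then show ?thesis by argo
  qed
  then show "c = c'" "l = l'" by (auto simp: vec_eq_iff)
qed

lemma inj_on_cub_triple: "inj_on (\<lambda>p. cub (triple p)) {p. 0 < snd p}"
proof (rule inj_onI)
  fix p q :: "(real ^ 'n) \<times> real"
  assume "p \<in> {p. 0 < snd p}" "q \<in> {p. 0 < snd p}" "cub (triple p) = cub (triple q)"
  then show "p = q"
    using cube_inject[of "3 * snd p" "3 * snd q" "fst p" "fst q"] by (simp add: prod_eq_iff)
qed

lemma finite_digits: "finite (digits :: (real ^ 'n::finite) set)"
proof (rule finite_subset)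
  show "(digits :: (real ^ 'n) set) \<subseteq> (\<lambda>f. \<chi> i. f i) ` (UNIV \<rightarrow>\<^sub>E {-1, 0, 1})"
  proof
    fix v :: "real ^ 'n" assume "v \<in> digits"
    then show "v \<in> (\<lambda>f. \<chi> i. f i) ` (UNIV \<rightarrow>\<^sub>E {-1, 0, 1})"
      by (intro image_eqI[of _ _ "\<lambda>i. v $ i"]) (auto simp: digits_def)
  qed
qed (auto intro!: finite_PiE)

lemma countable_words: "countable (lists (digits :: (real ^ 'n::finite) set))"
  using finite_digits by (intro countable_lists countable_finite)

lemma digit_abs: "v \<in> digits \<Longrightarrow> \<bar>v $ i\<bar> \<le> 1"
  by (auto simp: digits_def dest: spec[of _ i])

lemma child_offset_abs:
  assumes "v \<in> digits" "0 < l"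
  shows "\<bar>l / 3 * v $ i\<bar> \<le> l / 3"
  using digit_abs[OF assms(1), of i] assms(2) by (simp add: abs_mult mult_left_le)

lemma cub_child_subset:
  assumes "v \<in> digits" "0 < snd p"
  shows "cub (child v p) \<subseteq> cub p"
proof
  fix x assume x: "x \<in> cub (child v p)"
  show "x \<in> cub p"
    unfolding cube_def
  proof safe
    fix i
    have "\<bar>x $ i - (fst p $ i + snd p / 3 * v $ i)\<bar> < snd p / 3 / 2"
      using x by (simp add: cube_def)
    with child_offset_abs[OF assms, of i] show "\<bar>x $ i - fst p $ i\<bar> < snd p / 2"
      by arith
  qed
qed

lemma cub_triple_child_subset:
  assumes "v \<in> digits" "0 < snd p"
  shows "cub (triple (child v p)) \<subseteq> cub (triple p)"
proof
  fix x assume x: "x \<in> cub (triple (child v p))"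
  show "x \<in> cub (triple p)"
    unfolding cube_def
  proof safe
    fix i
    have "\<bar>x $ i - (fst p $ i + snd p / 3 * v $ i)\<bar> < 3 * (snd p / 3) / 2"
      using x by (simp add: cube_def)
    with child_offset_abs[OF assms, of i] show "\<bar>x $ i - fst (triple p) $ i\<bar> < snd (triple p) / 2"
      using assms(2) unfolding triple_simps by arith
  qed
qed

lemma child_disjoint:
  assumes "v \<in> digits" "v' \<in> digits" "v \<noteq> v'" "0 < snd p"
  shows "cub (child v p) \<inter> cub (child v' p) = {}"
proof (rule ccontr)
  assume "\<not> ?thesis"
  then obtain x where x: "x \<in> cub (child v p)" "x \<in> cub (child v' p)" by auto
  obtain i where i: "v $ i \<noteq> v' $ i" using assms(3) by (auto simp: vec_eq_iff)
  have "v $ i \<in> {-1,0,1}" "v' $ i \<in> {-1,0,1}" using assms by (auto simp: digits_def)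
  with i have "1 \<le> \<bar>v $ i - v' $ i\<bar>" by auto
  then have "snd p / 3 * 1 \<le> snd p / 3 * \<bar>v $ i - v' $ i\<bar>"
    using assms(4) by (intro mult_left_mono) auto
  also have "\<dots> = \<bar>snd p / 3 * v $ i - snd p / 3 * v' $ i\<bar>"
    using assms(4) unfolding right_diff_distrib[symmetric] by (simp add: abs_mult)
  finally have "snd p / 3 \<le> \<bar>snd p / 3 * v $ i - snd p / 3 * v' $ i\<bar>" by simp
  moreover have "\<bar>x $ i - (fst p $ i + snd p / 3 * v $ i)\<bar> < snd p / 3 / 2"
     "\<bar>x $ i - (fst p $ i + snd p / 3 * v' $ i)\<bar> < snd p / 3 / 2"
    using x by (simp_all add: cube_def)
  ultimately show False by (simp add: abs_if split: if_splits)
qed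

text \<open>
  Only the points on the finitely many hyperplanes that separate the children are lost.
\<close>

lemma AE_child_cover:
  fixes p :: "(real ^ 'n::finite) \<times> real"
  assumes "0 < snd p"
  shows "AE x in lebesgue. x \<in> cub p \<longrightarrow> (\<exists>v\<in>digits. x \<in> cub (child v p))"
proof -
  have hyperplane: "negligible {x :: real ^ 'n. x $ i = a}" for i a
    unfolding cart_eq_inner_axis by (rule negligible_standard_hyperplane) simp
  define h where "h s i = {x. x $ i = fst p $ i + s * snd p / 6}" for s :: real and i
  have "h s i \<in> null_sets lebesgue" for s i
    using hyperplane[of i "fst p $ i + s * snd p / 6"]
    by (simp add: h_def negligible_iff_null_sets)
  then have "AE x in lebesgue. x \<notin> h s i" for s i
    by (rule AE_not_in)
  then have "AE x in lebesgue. \<forall>i. x \<notin> h 1 i \<and> x \<notin> h (-1) i"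
    by (subst AE_all_countable) auto
  then show ?thesis
  proof eventually_elim
    case (elim x)
    show ?case
    proof
      assume x: "x \<in> cub p"
      define v :: "real ^ 'n" where "v = (\<chi> i. if x $ i - fst p $ i > snd p / 6 then 1
        else if x $ i - fst p $ i < - snd p / 6 then -1 else 0)"
      have "v \<in> digits" by (auto simp: digits_def v_def)
      moreover have "x \<in> cub (child v p)"
        unfolding cube_def
      proof safe
        fix i
        have "\<bar>x $ i - fst p $ i\<bar> < snd p / 2" using x by (simp add: cube_def)
        moreover have "x $ i \<noteq> fst p $ i + snd p / 6" "x $ i \<noteq> fst p $ i - snd p / 6"
          using elim[rule_format, of i] by (auto simp: h_def)
        ultimately show "\<bar>x $ i - fst (child v p) $ i\<bar> < snd (child v p) / 2"
          by (auto simp: v_def abs_if split: if_splits)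
      qed
      ultimately show "\<exists>v\<in>digits. x \<in> cub (child v p)" by blast
    qed
  qed
qed

section \<open>Stopping cubes of an open set\<close>

text \<open>
  Triadic subcubes are addressed by words of digits, so that inclusion of subcubes becomes the prefix
  order and maximal subcubes correspond to minimal words.
\<close>

definition descendant :: "(real ^ 'n::finite) \<times> real \<Rightarrow> (real ^ 'n) list \<Rightarrow> (real ^ 'n) \<times> real" where
  "descendant p w = foldl (\<lambda>q v. child v q) p w"

lemma descendant_simps [simp]:
  "descendant p [] = p" "descendant p (w @ [v]) = child v (descendant p w)"
  by (simp_all add: descendant_def)

lemma snd_descendant: "snd (descendant p w) = snd p / 3 ^ length w"
  by (induction w rule: rev_induct) auto

lemma descendant_pos: "0 < snd p \<Longrightarrow> 0 < snd (descendant p w)"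
  by (simp add: snd_descendant)

lemma descendant_subset:
  assumes "0 < snd p" "u \<in> lists digits"
  shows "cub (descendant p (w @ u)) \<subseteq> cub (descendant p w)"
  using assms(2)
proof (induction u rule: rev_induct)
  case (snoc v u)
  then show ?case
    using cub_child_subset[of v "descendant p (w @ u)"] descendant_pos[OF assms(1)]
    by (simp add: append_assoc[symmetric] del: append_assoc)
qed simp

lemma triple_descendant_subset:
  assumes "0 < snd p" "u \<in> lists digits"
  shows "cub (triple (descendant p u)) \<subseteq> cub (triple p)"
  using assms(2)
proof (induction u rule: rev_induct)
  case (snoc v u)
  then have "cub (triple (descendant p (u @ [v]))) \<subseteq> cub (triple (descendant p u))"
    using cub_triple_child_subset[of v "descendant p u"] descendant_pos[OF assms(1), of u] by simp
  then show ?case using snoc by auto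
qed simp

text \<open>
  At the first digit where the two words differ, they enter two different children of the same cube.
\<close>

lemma descendant_disjoint:
  assumes "0 < snd p" "w \<in> lists digits" "w' \<in> lists digits" "parallel w w'"
  shows "cub (descendant p w) \<inter> cub (descendant p w') = {}"
proof -
  obtain z v u v' u' where z: "v \<noteq> v'" "w = z @ v # u" "w' = z @ v' # u'"
    using parallel_decomp[OF assms(4)] by blast
  have "cub (descendant p w) \<subseteq> cub (child v (descendant p z))"
    using descendant_subset[OF assms(1), of u "z @ [v]"] assms(2) z by simp
  moreover have "cub (descendant p w') \<subseteq> cub (child v' (descendant p z))"
    using descendant_subset[OF assms(1), of u' "z @ [v']"] assms(3) z by simp
  moreover have "cub (child v (descendant p z)) \<inter> cub (child v' (descendant p z)) = {}"
    using child_disjoint[of v v'] assms z descendant_pos[OF assms(1), of z] by auto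
  ultimately show ?thesis by blast
qed

lemma AE_descendant_cover:
  assumes "0 < snd p"
  shows "AE x in lebesgue. x \<in> cub p \<longrightarrow>
    (\<forall>k. \<exists>w\<in>lists digits. length w = k \<and> x \<in> cub (descendant p w))"
proof -
  have "AE x in lebesgue. \<forall>w\<in>lists digits. x \<in> cub (descendant p w) \<longrightarrow>
      (\<exists>v\<in>digits. x \<in> cub (child v (descendant p w)))"
    by (intro AE_ball_countable' countable_words AE_child_cover descendant_pos assms)
  then show ?thesis
  proof eventually_elim
    case (elim x)
    show ?case
    proof (intro impI allI)
      fix k assume x: "x \<in> cub p"
      show "\<exists>w\<in>lists digits. length w = k \<and> x \<in> cub (descendant p w)"
      proof (induction k)
        case 0
        then show ?case using x by (intro bexI[of _ "[]"]) auto
      next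
        case (Suc k)
        then obtain w where w: "w \<in> lists digits" "length w = k" "x \<in> cub (descendant p w)" by blast
        then obtain v where "v \<in> digits" "x \<in> cub (child v (descendant p w))" using elim by blast
        then show ?case using w by (intro bexI[of _ "w @ [v]"]) auto
      qed
    qed
  qed
qed

lemma small_cube_in_open:
  fixes U :: "(real ^ 'n::finite) set"
  assumes "open U" "x \<in> U"
  obtains d where "0 < d" "\<And>p. x \<in> cub p \<Longrightarrow> snd p < d \<Longrightarrow> cub p \<subseteq> U"
proof -
  obtain e where e: "0 < e" "ball x e \<subseteq> U" using assms open_contains_ball by blast
  show thesis
  proof
    show "0 < e / CARD('n)" using e by simp
    fix p assume p: "x \<in> cub p" "snd p < e / CARD('n)"
    show "cub p \<subseteq> U"
    proof
      fix y assume y: "y \<in> cub p"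
      have "\<bar>(x - y) $ i\<bar> \<le> snd p" for i
      proof -
        have "\<bar>x $ i - fst p $ i\<bar> < snd p / 2" "\<bar>y $ i - fst p $ i\<bar> < snd p / 2"
          using p y by (simp_all add: cube_def)
        then show ?thesis by (simp add: abs_if split: if_splits)
      qed
      then have "norm (x - y) \<le> (\<Sum>i\<in>(UNIV::'n set). snd p)"
        using norm_le_l1_cart[of "x - y"] by (meson order_trans sum_mono)
      also have "\<dots> < e" using p(2) by (simp add: field_simps)
      finally show "y \<in> U" using e by (auto simp: dist_norm)
    qed
  qed
qed

text \<open>
  The stopping cubes are the maximal triadic subcubes having a child inside \<open>U\<close>. Such a child occupies
  the fraction \<open>3^(-n)\<close> of the cube, so the total measure of the stopping cubes is at most \<open>3^n\<close> times
  that of \<open>U \<inter> p\<close>. By smallness \<open>p\<close> itself does not qualify; hence every stopping cube has a parent,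
  and if it were contained in \<open>U\<close> this parent would qualify, against maximality. They cover \<open>U \<inter> p\<close> up
  to a null set because \<open>U\<close> is open: small subcubes around a point of \<open>U\<close> lie in \<open>U\<close>.
\<close>

lemma stopping_cubes:
  fixes U :: "(real ^ 'n::finite) set"
  assumes U: "open U" and p: "0 < snd p"
    and small: "emeasure lebesgue (U \<inter> cub p) \<le> ennreal (1 / (2 * 3 ^ CARD('n)) * snd p ^ CARD('n))"
  obtains N where "N \<subseteq> {q. 0 < snd q}" "countable N" "disjoint_family_on cub N"
    "\<forall>q\<in>N. cub q \<subseteq> cub p \<and> cub (triple q) \<subseteq> cub (triple p) \<and> \<not> cub q \<subseteq> U"
    "emeasure lebesgue (\<Union>(cub ` N)) \<le> ennreal (1/2) * emeasure lebesgue (cub p)"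
    "AE x in lebesgue. x \<in> cub p - \<Union>(cub ` N) \<longrightarrow> x \<notin> U"
proof -
  define good where "good w \<longleftrightarrow> (\<exists>v\<in>digits. cub (child v (descendant p w)) \<subseteq> U)" for w
  define W where "W = {w \<in> lists digits. good w \<and> (\<forall>w'. strict_prefix w' w \<longrightarrow> \<not> good w')}"
  define N where "N = descendant p ` W"
  let ?n = "CARD('n)"
  have W: "W \<subseteq> lists digits" by (auto simp: W_def)
  have sub: "cub q \<subseteq> cub p" if "q \<in> N" for q
    using that W descendant_subset[OF p, of _ "[]"] by (fastforce simp: N_def)
  have pos: "N \<subseteq> {q. 0 < snd q}" using descendant_pos[OF p] by (auto simp: N_def)
  have cnt: "countable N" unfolding N_def using countable_words W countable_subset by blast
  have disj: "disjoint_family_on cub N"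
    unfolding disjoint_family_on_def N_def
  proof (intro ballI impI)
    fix q q' assume "q \<in> descendant p ` W" "q' \<in> descendant p ` W" and ne: "q \<noteq> q'"
    then obtain w w' where q: "q = descendant p w" "q' = descendant p w'" and w: "w \<in> W" "w' \<in> W"
      by blast
    then have "w \<noteq> w'" using ne by auto
    moreover have "\<not> strict_prefix w w'" "\<not> strict_prefix w' w" using w by (auto simp: W_def)
    ultimately have "parallel w w'" by (auto simp: parallel_def strict_prefix_def)
    then show "cub q \<inter> cub q' = {}" using descendant_disjoint[OF p] w W unfolding q by blast
  qed
  have notsub: "\<not> cub q \<subseteq> U" if q: "q \<in> N" for q
  proof -
    obtain w where w: "w \<in> W" "q = descendant p w" using q unfolding N_def by blast
    have "\<not> good []"
    proof
      assume "good []"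
      then obtain v where v: "v \<in> digits" "cub (child v p) \<subseteq> U" by (auto simp: good_def)
      then have "cub (child v p) \<subseteq> U \<inter> cub p" using cub_child_subset p by blast
      then have "emeasure lebesgue (cub (child v p)) \<le> emeasure lebesgue (U \<inter> cub p)"
        using U by (intro emeasure_mono sets.Int) auto
      also note small
      also have "emeasure lebesgue (cub (child v p)) = ennreal ((snd p / 3) ^ ?n)"
        using p by (subst emeasure_cube) auto
      finally have "(snd p / 3) ^ ?n \<le> 1 / (2 * 3 ^ ?n) * snd p ^ ?n"
        using p by (subst (asm) ennreal_le_iff) auto
      then show False using p by (simp add: power_divide field_simps)
    qed
    then have "w \<noteq> []" using w by (auto simp: W_def)
    then obtain w' v where wv: "w = w' @ [v]" by (metis rev_exhaust)
    then have "strict_prefix w' w" by (simp add: strict_prefix_def)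
    then have "\<not> good w'" "v \<in> digits" using w wv by (auto simp: W_def)
    then show ?thesis using w wv by (auto simp: good_def)
  qed
  have big: "emeasure lebesgue (\<Union>(cub ` N)) \<le> ennreal (1/2) * emeasure lebesgue (cub p)"
  proof -
    have "\<forall>q\<in>N. \<exists>v\<in>digits. cub (child v q) \<subseteq> U" by (auto simp: N_def W_def good_def)
    then obtain c where c: "\<And>q. q \<in> N \<Longrightarrow> c q \<in> digits \<and> cub (child (c q) q) \<subseteq> U" by metis
    have sub': "cub (child (c q) q) \<subseteq> cub q" if "q \<in> N" for q
      using cub_child_subset c pos that by blast
    have "emeasure lebesgue (\<Union>(cub ` N))
        \<le> ennreal (3 ^ ?n) * emeasure lebesgue (\<Union>q\<in>N. cub (child (c q) q))"
    proof (rule emeasure_UN_le_cmult[OF cnt disj])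
      show "disjoint_family_on (\<lambda>q. cub (child (c q) q)) N"
        using disj sub' unfolding disjoint_family_on_def by blast
      fix q assume q: "q \<in> N"
      then have "0 < snd q" using pos by auto
      then show "emeasure lebesgue (cub q) \<le> ennreal (3 ^ ?n) * emeasure lebesgue (cub (child (c q) q))"
        by (simp add: emeasure_cube ennreal_mult'[symmetric] power_divide del: emeasure_completion)
    qed auto
    also have "\<dots> \<le> ennreal (3 ^ ?n) * emeasure lebesgue (U \<inter> cub p)"
    proof (intro mult_left_mono emeasure_mono)
      show "(\<Union>q\<in>N. cub (child (c q) q)) \<subseteq> U \<inter> cub p"
        using c sub sub' by blast
    qed (use U in \<open>auto intro: sets.Int\<close>)
    also have "\<dots> \<le> ennreal (3 ^ ?n) * ennreal (1 / (2 * 3 ^ ?n) * snd p ^ ?n)"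
      by (intro mult_left_mono small) auto
    also have "\<dots> = ennreal (1/2) * emeasure lebesgue (cub p)"
      using p by (simp add: emeasure_cube ennreal_mult'[symmetric] del: ennreal_half emeasure_completion)
    finally show ?thesis .
  qed
  have cover: "AE x in lebesgue. x \<in> cub p - \<Union>(cub ` N) \<longrightarrow> x \<notin> U"
    using AE_descendant_cover[OF p]
  proof eventually_elim
    case (elim x)
    have "x \<in> \<Union>(cub ` N)" if x: "x \<in> cub p" "x \<in> U"
    proof -
      obtain d where d: "0 < d" "\<And>q. x \<in> cub q \<Longrightarrow> snd q < d \<Longrightarrow> cub q \<subseteq> U"
        using small_cube_in_open[OF U x(2)] by blast
      obtain k where k: "snd p / d < 3 ^ k" using real_arch_pow[of 3 "snd p / d"] by auto
      obtain w where w: "w \<in> lists digits" "length w = Suc k" "x \<in> cub (descendant p w)"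
        using elim x(1) by blast
      obtain w1 v where wv: "w = w1 @ [v]" using w(2) by (metis length_Suc_conv_rev)
      have "snd p < d * 3 ^ k" using k d(1) by (simp add: field_simps)
      also have "\<dots> \<le> d * 3 ^ Suc k" using d(1) by simp
      finally have "snd (descendant p w) < d"
        unfolding snd_descendant w(2) by (simp add: field_simps)
      then have "cub (descendant p w) \<subseteq> U" using d(2) w(3) by blast
      then have "good w1" using w wv by (auto simp: good_def)
      \<comment> \<open>The shortest qualifying prefix addresses the stopping cube that contains \<open>x\<close>.\<close>
      define j where "j = (LEAST j. good (take j w1))"
      have good_j: "good (take j w1)"
        unfolding j_def by (rule LeastI[of "\<lambda>j. good (take j w1)" "length w1"]) (use \<open>good w1\<close> in simp)
      have min: "\<not> good (take i w1)" if "i < j" for i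
        using not_less_Least that unfolding j_def by blast
      have "take j w1 \<in> W"
        unfolding W_def
      proof (intro CollectI conjI allI impI good_j)
        show "take j w1 \<in> lists digits" using w wv by (auto dest: in_set_takeD)
        fix w' assume sp: "strict_prefix w' (take j w1)"
        then have "length w' < j" using prefix_length_less by fastforce
        moreover have "w' = take (length w') w1"
        proof -
          have "prefix w' w1" using sp take_is_prefix[of j w1] prefix_order.trans prefix_order.less_imp_le by blast
          then show ?thesis by (auto simp: prefix_def)
        qed
        ultimately show "\<not> good w'" using min by metis
      qed
      moreover have "x \<in> cub (descendant p (take j w1))"
      proof -
        have eq: "take j w1 @ drop j w1 @ [v] = w" using wv by simp
        have "drop j w1 @ [v] \<in> lists digits" using w wv by (auto dest: in_set_dropD)
        from descendant_subset[OF p this, of "take j w1"] w(3) show ?thesis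
          unfolding eq by (rule subsetD)
      qed
      ultimately show ?thesis by (auto simp: N_def)
    qed
    then show ?case by blast
  qed
  have "cub (triple q) \<subseteq> cub (triple p)" if "q \<in> N" for q
    using that W triple_descendant_subset[OF p] unfolding N_def by blast
  then show thesis using that[OF pos cnt disj _ big cover] sub notsub by blast
qed

section \<open>A tiling by cubes whose triples contain a fixed cube\<close>

lemma cube_mono: "l \<le> l' \<Longrightarrow> cube c l \<subseteq> cube c l'"
  unfolding cube_def by (intro Collect_mono impI allI) (meson divide_right_mono less_le_trans zero_le_numeral)

text \<open>
  The cube of side \<open>3^(k+1) * L\<close> around the origin splits into its central child, which is the cube of
  side \<open>3^k * L\<close>, and \<open>3^n - 1\<close> outer children adjacent to it, whose triples contain that central child.
  The outer children for all \<open>k\<close>, together with the cube of side \<open>L\<close>, tile the space up to a null set.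
\<close>

lemma shell_cubes:
  assumes L: "0 < L"
  obtains R :: "((real ^ 'n::finite) \<times> real) set"
  where "R \<subseteq> {p. 0 < snd p}" "countable R" "disjoint_family_on cub R"
    "AE x in lebesgue. \<exists>p\<in>R. x \<in> cub p" "\<forall>p\<in>R. cube 0 L \<subseteq> cub (triple p)"
proof -
  define b where "b k = ((0 :: real ^ 'n), 3 ^ k * L)" for k
  define R where "R = insert (b 0) (\<Union>k. (\<lambda>v. child v (b (Suc k))) ` (digits - {0}))"
  have b_pos: "0 < snd (b k)" for k using L by (simp add: b_def)
  have child0: "child 0 (b (Suc k)) = b k" for k by (simp add: b_def child_def)
  have zero: "0 \<in> digits" by (simp add: digits_def)
  have b_mono: "cub (b j) \<subseteq> cub (b k)" if "j \<le> k" for j k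
    unfolding b_def using that L by (simp add: cube_mono)
  have sub: "cub (child v (b k)) \<subseteq> cub (b k)" if "v \<in> digits" for v k
    using cub_child_subset[OF that b_pos] .
  have pos: "R \<subseteq> {p. 0 < snd p}" using b_pos L by (auto simp: R_def b_def)
  have cnt: "countable R" unfolding R_def using finite_digits
    by (intro countable_insert countable_UN countable_image) (auto intro: countable_finite)
  \<comment> \<open>The outer children of one shell avoid its centre and hence everything built at smaller scales.\<close>
  have disj_b: "cub (child v (b (Suc k))) \<inter> cub (b j) = {}" if "v \<in> digits - {0}" "j \<le> k" for v k j
    using child_disjoint[of v 0 "b (Suc k)"] zero b_pos[of "Suc k"] that b_mono[OF that(2)]
    unfolding child0 by blast
  have disj_c: "cub (child v (b (Suc k))) \<inter> cub (child v' (b (Suc j))) = {}"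
    if "v \<in> digits - {0}" "v' \<in> digits - {0}" "j < k" for v v' k j
    using disj_b[OF that(1), of "Suc j" k] sub[of v' "Suc j"] that by auto
  have disj_d: "cub (child v (b (Suc k))) \<inter> cub (child v' (b (Suc j))) = {}"
    if "v \<in> digits - {0}" "v' \<in> digits - {0}" "child v (b (Suc k)) \<noteq> child v' (b (Suc j))" for v v' k j
  proof -
    consider "j < k" | "k < j" | "j = k" by linarith
    then show ?thesis
    proof cases
      case 1
      then show ?thesis using disj_c that by blast
    next
      case 2
      then show ?thesis using disj_c[of v' v k j] that by blast
    next
      case 3
      then have "v \<noteq> v'" using that by auto
      then show ?thesis using child_disjoint[of v v' "b (Suc k)"] b_pos[of "Suc k"] that 3 by simp
    qed
  qed
  have disj: "disjoint_family_on cub R"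
    unfolding disjoint_family_on_def
  proof (intro ballI impI)
    fix p q assume pq: "p \<in> R" "q \<in> R" "p \<noteq> q"
    consider "p = b 0" "q = b 0"
      | v k where "p = b 0" "v \<in> digits - {0}" "q = child v (b (Suc k))"
      | v k where "q = b 0" "v \<in> digits - {0}" "p = child v (b (Suc k))"
      | v k v' k' where "v \<in> digits - {0}" "q = child v (b (Suc k))"
         "v' \<in> digits - {0}" "p = child v' (b (Suc k'))"
      using pq(1,2) unfolding R_def by blast
    then show "cub p \<inter> cub q = {}"
    proof cases
      case 1
      then show ?thesis using pq(3) by simp
    next
      case 2
      then show ?thesis using disj_b[of v 0 k] by blast
    next
      case 3
      then show ?thesis using disj_b[of v 0 k] by blast
    next
      case 4
      then show ?thesis using disj_d[of v' v k' k] pq(3) by blast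
    qed
  qed
  have cover: "AE x in lebesgue. \<exists>p\<in>R. x \<in> cub p"
  proof -
    have "AE x in lebesgue. \<forall>k. x \<in> cub (b k) \<longrightarrow> (\<exists>v\<in>digits. x \<in> cub (child v (b k)))"
      unfolding AE_all_countable using AE_child_cover b_pos by blast
    then show ?thesis
    proof eventually_elim
      case (elim x)
      have "\<exists>k. x \<in> cub (b k)"
      proof -
        obtain k where k: "2 * norm x / L < 3 ^ k" using real_arch_pow[of 3 "2 * norm x / L"] by auto
        have "\<bar>x $ i\<bar> < 3 ^ k * L / 2" for i
          using component_le_norm_cart[of x i] k L by (simp add: field_simps)
        then show ?thesis by (intro exI[of _ k]) (simp add: b_def cube_def)
      qed
      then obtain k where k: "x \<in> cub (b k)" and min: "\<And>j. j < k \<Longrightarrow> x \<notin> cub (b j)"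
        using exists_least_iff[of "\<lambda>k. x \<in> cub (b k)"] by blast
      show ?case
      proof (cases k)
        case 0
        then show ?thesis using k by (auto simp: R_def)
      next
        case (Suc j)
        then obtain v where v: "v \<in> digits" "x \<in> cub (child v (b (Suc j)))" using elim k by blast
        moreover have "v \<noteq> 0"
          using v(2) child0[of j] min[of j] Suc by (auto simp del: child_simps)
        ultimately show ?thesis unfolding R_def by blast
      qed
    qed
  qed
  have trip: "cube 0 L \<subseteq> cub (triple p)" if "p \<in> R" for p
  proof -
    have "cube 0 L \<subseteq> cub (triple (child v (b (Suc k))))" if v: "v \<in> digits" for v k
    proof
      fix x :: "real ^ 'n" assume "x \<in> cube 0 L"
      then have "x \<in> cub (b k)" using b_mono[of 0 k] by (auto simp: b_def)
      then have x: "\<bar>x $ i\<bar> < 3 ^ k * L / 2" for i by (simp add: b_def cube_def)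
      have d: "\<bar>3 ^ k * L * v $ i\<bar> \<le> 3 ^ k * L" for i
        using digit_abs[OF v, of i] L by (simp add: abs_mult mult_left_le)
      have "\<bar>x $ i - 3 ^ k * L * v $ i\<bar> < 3 * (3 ^ k * L) / 2" for i
        using x[of i] d[of i] by arith
      then show "x \<in> cub (triple (child v (b (Suc k))))"
        by (simp add: cube_def b_def)
    qed
    moreover have "cube 0 L \<subseteq> cub (triple (b 0))" using L by (simp add: b_def cube_mono)
    ultimately show ?thesis using that by (auto simp: R_def simp del: triple_simps child_simps)
  qed
  show thesis using that[OF pos cnt disj cover] trip by blast
qed

section \<open>Restriction to a set, and averages\<close>

text \<open>
  The graph of the concave function \<open>y powr \<theta>\<close> lies below its tangent at \<open>y = 1\<close>.
\<close>

lemma powr_le_tangent: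
  fixes y :: real
  assumes "0 \<le> y" "0 < \<theta>" "\<theta> \<le> 1"
  shows "y powr \<theta> \<le> 1 - \<theta> + \<theta> * y"
proof (cases "y = 0")
  case False
  then show ?thesis
    using assms Youngs_inequality_0[of \<theta> "1 - \<theta>" y 1] by simp
qed (use assms in auto)

lemma indicator_mult_powr:
  "(indicat_real A x * u) powr p = indicator A x * u powr p"
  by (auto simp: indicator_def)

lemma restrict_in_Lp:
  fixes f :: "real ^ 'n::finite \<Rightarrow> 'b::euclidean_space"
  assumes "f \<in> Lp p" "A \<in> sets lebesgue"
  shows "(\<lambda>y. indicator A y *\<^sub>R f y) \<in> Lp p"
proof -
  have f: "f \<in> borel_measurable lebesgue" "integrable lebesgue (\<lambda>x. norm (f x) powr p)"
    using assms by (auto simp: Lp_def)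
  have "integrable lebesgue (\<lambda>x. indicator A x *\<^sub>R norm (f x) powr p)"
    using assms(2) f(2) by (rule integrable_mult_indicator)
  moreover have "(\<lambda>y. indicator A y *\<^sub>R f y) \<in> borel_measurable lebesgue"
    using assms(2) f(1) by measurable
  ultimately show ?thesis by (simp add: Lp_def indicator_mult_powr)
qed

text \<open>
  The inequality \<open>u powr s \<le> 1 + u powr r\<close> is integrable over a set of finite measure.
\<close>

lemma restrict_in_lower_Lp:
  fixes f :: "real ^ 'n::finite \<Rightarrow> 'b::euclidean_space"
  assumes "f \<in> Lp r" "s \<le> r" "0 < s" "A \<in> sets lebesgue" "emeasure lebesgue A < \<infinity>"
  shows "(\<lambda>y. indicator A y *\<^sub>R f y) \<in> Lp s"
proof -
  have f: "f \<in> borel_measurable lebesgue" "integrable lebesgue (\<lambda>x. norm (f x) powr r)"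
    using assms by (auto simp: Lp_def)
  have m: "(\<lambda>y. indicator A y *\<^sub>R f y) \<in> borel_measurable lebesgue"
    using assms(4) f(1) by measurable
  have "integrable lebesgue (\<lambda>x. indicator A x * norm (f x) powr s)"
  proof (rule Bochner_Integration.integrable_bound)
    show "integrable lebesgue (\<lambda>x. indicat_real A x + indicator A x *\<^sub>R norm (f x) powr r)"
      using assms f by (intro Bochner_Integration.integrable_add integrable_mult_indicator) auto
    show "(\<lambda>x. indicator A x * norm (f x) powr s) \<in> borel_measurable lebesgue"
      using assms(4) f(1) by measurable
    have "u powr s \<le> 1 + u powr r" if "0 \<le> u" for u :: real
    proof (cases "u \<le> 1")
      case True
      then have "u powr s \<le> 1" using that assms(3) powr_le1 by simp
      then show ?thesis using powr_ge_zero[of u r] by linarith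
    next
      case False
      then have "u powr s \<le> u powr r" using assms by (intro powr_mono) auto
      then show ?thesis by linarith
    qed
    then show "AE x in lebesgue. norm (indicator A x * norm (f x) powr s)
        \<le> norm (indicat_real A x + indicator A x *\<^sub>R norm (f x) powr r)"
      by (intro AE_I2) (auto simp: indicator_def)
  qed
  then show ?thesis using m by (simp add: Lp_def indicator_mult_powr)
qed

lemma Lp_norm_nonneg: "0 \<le> Lp_norm p f"
  by (simp add: Lp_norm_def)

lemma Lp_average_nonneg: "0 \<le> Lp_average r f Q"
  by (simp add: Lp_average_def)

text \<open>
  This is Jensen's inequality for the normalised measure on \<open>Q\<close>. With \<open>J\<close> the mean of \<open>|f|^r\<close>, the
  tangent inequality at \<open>|f|^r / J\<close> with exponent \<open>\<theta> = s / r\<close> integrates to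
  \<open>\<integral>\<^sub>Q |f|^s \<le> J powr \<theta> * |Q|\<close>, since the mean of \<open>|f|^r / J\<close> is one.
\<close>

lemma Lp_norm_restrict_le_average:
  fixes f :: "real ^ 'n::finite \<Rightarrow> 'b::euclidean_space"
  assumes f: "f \<in> Lp r" and s: "0 < s" "s \<le> r"
    and Q: "Q \<in> sets lebesgue" "emeasure lebesgue Q < \<infinity>" "0 < measure lebesgue Q"
  shows "Lp_norm s (\<lambda>y. indicator Q y *\<^sub>R f y)
    \<le> measure lebesgue Q powr (1 / s) * Lp_average r f Q"
proof -
  define V where "V = measure lebesgue Q"
  define G where "G = (\<lambda>x. indicator Q x * norm (f x) powr r)"
  define H where "H = (\<lambda>x. indicator Q x * norm (f x) powr s)"
  define J where "J = 1 / V * integral\<^sup>L lebesgue G"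
  define \<theta> where "\<theta> = s / r"
  have V: "0 < V" using Q by (simp add: V_def)
  have \<theta>: "0 < \<theta>" "\<theta> \<le> 1" using s by (auto simp: \<theta>_def)
  have G: "integrable lebesgue G"
    using restrict_in_Lp[OF f Q(1)] by (simp add: Lp_def indicator_mult_powr G_def)
  have H: "integrable lebesgue H"
    using restrict_in_lower_Lp[OF f s(2,1) Q(1,2)] by (simp add: Lp_def indicator_mult_powr H_def)
  have G0: "0 \<le> G x" and H0: "0 \<le> H x" for x by (auto simp: G_def H_def)
  have J0: "0 \<le> J" unfolding J_def using V G0 by (intro mult_nonneg_nonneg integral_nonneg) auto
  have "integral\<^sup>L lebesgue H \<le> J powr \<theta> * V"
  proof (cases "J = 0")
    case True
    then have "integral\<^sup>L lebesgue G = 0" using V by (simp add: J_def)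
    then have "AE x in lebesgue. G x = 0"
      using integral_nonneg_eq_0_iff_AE[OF G] G0 by simp
    then have "AE x in lebesgue. H x = 0"
      by eventually_elim (auto simp: G_def H_def)
    then have "integral\<^sup>L lebesgue H = 0" by (rule integral_eq_zero_AE)
    then show ?thesis using V by simp
  next
    case False
    then have J: "0 < J" using J0 by simp
    let ?K = "\<lambda>x. J powr \<theta> * ((1 - \<theta>) * indicat_real Q x + \<theta> / J * G x)"
    have K: "integrable lebesgue ?K" using G Q by auto
    have "integral\<^sup>L lebesgue H \<le> integral\<^sup>L lebesgue ?K"
    proof (rule integral_mono[OF H K])
      fix x
      show "H x \<le> ?K x"
      proof (cases "x \<in> Q")
        case True
        define u where "u = norm (f x) powr r / J"
        have "u powr \<theta> \<le> 1 - \<theta> + \<theta> * u"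
          using J \<theta> by (intro powr_le_tangent) (auto simp: u_def)
        then have "J powr \<theta> * u powr \<theta> \<le> J powr \<theta> * (1 - \<theta> + \<theta> * u)"
          by (intro mult_left_mono) auto
        moreover have "J powr \<theta> * u powr \<theta> = norm (f x) powr s"
        proof -
          have "J powr \<theta> * u powr \<theta> = (J * u) powr \<theta>"
            using J by (subst powr_mult) (auto simp: u_def)
          also have "J * u = norm (f x) powr r" using J by (simp add: u_def)
          also have "\<dots> powr \<theta> = norm (f x) powr s"
            using s by (simp add: powr_powr \<theta>_def)
          finally show ?thesis .
        qed
        ultimately show ?thesis using True by (simp add: H_def G_def u_def)
      qed (simp add: H_def G_def)
    qed
    also have "integral\<^sup>L lebesgue ?K = J powr \<theta> * ((1 - \<theta>) * V + \<theta> / J * integral\<^sup>L lebesgue G)"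
      using G Q by (simp add: V_def)
    also have "integral\<^sup>L lebesgue G = J * V" using V by (simp add: J_def)
    also have "J powr \<theta> * ((1 - \<theta>) * V + \<theta> / J * (J * V)) = J powr \<theta> * V"
      using J by (simp add: algebra_simps)
    finally show ?thesis .
  qed
  then have "integral\<^sup>L lebesgue H powr (1 / s) \<le> (J powr \<theta> * V) powr (1 / s)"
    using H0 s by (intro powr_mono2 integral_nonneg) auto
  also have "\<dots> = V powr (1 / s) * J powr (1 / r)"
    using V s by (simp add: powr_mult powr_powr \<theta>_def)
  finally show ?thesis
    by (simp add: Lp_norm_def indicator_mult_powr H_def Lp_average_def J_def G_def V_def
        set_lebesgue_integral_def)
qed

lemma prod_Lp_norm_restrict_le:
  fixes f :: "'m::finite \<Rightarrow> real ^ 'n::finite \<Rightarrow> 'b::euclidean_space"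
  assumes f: "\<And>i. f i \<in> Lp r" and s: "0 < s" "s \<le> r"
    and Q: "Q \<in> sets lebesgue" "emeasure lebesgue Q < \<infinity>" "0 < measure lebesgue Q"
  shows "(\<Prod>i\<in>UNIV. Lp_norm s (restrict_tuple Q f i))
    \<le> measure lebesgue Q powr (real CARD('m) / s) * (\<Prod>i\<in>UNIV. Lp_average r (f i) Q)"
proof -
  have "(\<Prod>i\<in>UNIV. Lp_norm s (restrict_tuple Q f i))
      \<le> (\<Prod>i\<in>(UNIV::'m set). measure lebesgue Q powr (1 / s) * Lp_average r (f i) Q)"
    unfolding restrict_tuple_def
    using Lp_norm_restrict_le_average[OF f s Q] Lp_norm_nonneg by (intro prod_mono) auto
  also have "\<dots> = (measure lebesgue Q powr (1 / s)) ^ CARD('m) * (\<Prod>i\<in>UNIV. Lp_average r (f i) Q)"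
    by (simp add: prod.distrib)
  also have "(measure lebesgue Q powr (1 / s)) ^ CARD('m) = measure lebesgue Q powr (real CARD('m) / s)"
    using Q(3) by (simp add: powr_realpow[symmetric] powr_powr)
  finally show ?thesis .
qed

section \<open>Weak type bounds\<close>

text \<open>
  The bound required of an admissible constant is a closed condition on it, so it passes to the
  infimum of the admissible constants.
\<close>

lemma weak_op_norm_attained:
  fixes U :: "('m::finite \<Rightarrow> real ^ 'n::finite \<Rightarrow> 'b::euclidean_space) \<Rightarrow> real ^ 'n \<Rightarrow> ennreal"
  assumes "weak_bounded s U"
  shows "weak_type_const s U (weak_op_norm s U)"
proof -
  let ?S = "{C. weak_type_const s U C}"
  have ne: "?S \<noteq> {}" using assms by (auto simp: weak_bounded_def)
  have A0: "0 \<le> Inf ?S" using ne by (intro cInf_greatest) (auto simp: weak_type_const_def)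
  have "weak_norm (s / real CARD('m)) (U f) \<le> ennreal (Inf ?S * (\<Prod>i\<in>UNIV. Lp_norm s (f i)))"
    if f: "\<forall>i. f i \<in> Lp s" for f
  proof -
    define P where "P = (\<Prod>i\<in>UNIV. Lp_norm s (f i))"
    have P: "0 \<le> P" unfolding P_def by (intro prod_nonneg) (simp add: Lp_norm_nonneg)
    have le: "weak_norm (s / real CARD('m)) (U f) \<le> ennreal (C * P)" if "C \<in> ?S" for C
      using that f by (auto simp: weak_type_const_def P_def)
    obtain C0 where C0: "C0 \<in> ?S" using ne by blast
    obtain w where w: "weak_norm (s / real CARD('m)) (U f) = ennreal w" "0 \<le> w"
      using le[OF C0] by (cases "weak_norm (s / real CARD('m)) (U f)") (auto simp: top_unique)
    have wle: "w \<le> C * P" if "C \<in> ?S" for C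
    proof -
      have "0 \<le> C * P" using that P by (auto simp: weak_type_const_def)
      then show ?thesis using le[OF that] unfolding w(1) by simp
    qed
    have "w \<le> Inf ?S * P"
    proof (cases "P = 0")
      case True
      then show ?thesis using wle[OF C0] by simp
    next
      case False
      then have "0 < P" using P by simp
      then have "w / P \<le> Inf ?S" using wle ne by (intro cInf_greatest) (auto simp: divide_le_eq)
      then show ?thesis using \<open>0 < P\<close> by (simp add: divide_le_eq)
    qed
    then show ?thesis unfolding w(1) P_def[symmetric] by (rule ennreal_leI)
  qed
  then show ?thesis using A0 by (auto simp: weak_type_const_def weak_op_norm_def)
qed

text \<open>
  Chebyshev's bound at height \<open>\<tau>\<close>. The hypothesis compares the norm bound with \<open>D * \<tau>\<close> in a form that
  makes sense for \<open>\<tau> = 0\<close> as well: the estimate is proved at every height \<open>t > \<tau>\<close>, where one may divide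
  by \<open>t\<close>, and the superlevel sets increase to the one at height \<open>\<tau>\<close>. This covers
  vanishing operator norms and averages.
\<close>

lemma weak_type_superlevel:
  fixes U :: "('m::finite \<Rightarrow> real ^ 'n::finite \<Rightarrow> 'b::euclidean_space) \<Rightarrow> real ^ 'n \<Rightarrow> ennreal"
  assumes U: "weak_type_const s U C" and g: "\<And>i. g i \<in> Lp s" and s: "0 < s"
    and meas: "\<And>t. 0 < t \<Longrightarrow> {x. ennreal t < U g x} \<in> sets lebesgue"
    and "0 \<le> \<tau>" "0 < D" and le: "C * (\<Prod>i\<in>UNIV. Lp_norm s (g i)) \<le> D * \<tau>"
  shows "emeasure lebesgue {x. ennreal \<tau> < U g x} \<le> ennreal (D powr (s / real CARD('m)))"
proof -
  let ?m = "real CARD('m)"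
  have level: "emeasure lebesgue {x. ennreal t < U g x} \<le> ennreal (D powr (s / ?m))" if "\<tau> < t" for t
  proof -
    have t: "0 < t" using that \<open>0 \<le> \<tau>\<close> by simp
    let ?e = "emeasure lebesgue {x. ennreal t < U g x}"
    have "ennreal t * ennreal_powr ?e (1 / (s / ?m)) \<le> weak_norm (s / ?m) (U g)"
      unfolding weak_norm_def by (rule SUP_upper) (use t in auto)
    also have "\<dots> \<le> ennreal (C * (\<Prod>i\<in>UNIV. Lp_norm s (g i)))"
      using U g by (auto simp: weak_type_const_def)
    also have "\<dots> \<le> ennreal (D * t)"
      using le that \<open>0 < D\<close> by (intro ennreal_leI) (meson less_imp_le mult_left_mono order_trans)
    finally have *: "ennreal t * ennreal_powr ?e (1 / (s / ?m)) \<le> ennreal (D * t)" .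
    then have "?e \<noteq> \<infinity>" using t by (auto simp: ennreal_powr_def ennreal_mult_top top_unique)
    then obtain a where a: "?e = ennreal a" "0 \<le> a" by (cases ?e) auto
    have "ennreal (t * a powr (?m / s)) \<le> ennreal (D * t)"
      using * t a by (simp add: ennreal_powr_def ennreal_mult)
    then have "a powr (?m / s) \<le> D" using t \<open>0 < D\<close> by simp
    then have "(a powr (?m / s)) powr (s / ?m) \<le> D powr (s / ?m)"
      using s by (intro powr_mono2) auto
    then have "a \<le> D powr (s / ?m)" using s a by (simp add: powr_powr)
    then show ?thesis unfolding a(1) by (rule ennreal_leI)
  qed
  define B where "B n = {x. ennreal (\<tau> + 1 / real (Suc n)) < U g x}" for n
  have union: "{x. ennreal \<tau> < U g x} = (\<Union>n. B n)"
  proof (intro equalityI subsetI)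
    fix x assume x: "x \<in> {x. ennreal \<tau> < U g x}"
    show "x \<in> (\<Union>n. B n)"
    proof (cases "U g x")
      case (real u)
      then have "\<tau> < u" using x \<open>0 \<le> \<tau>\<close> by (simp add: ennreal_less_iff)
      then obtain n where "inverse (real (Suc n)) < u - \<tau>" using reals_Archimedean[of "u - \<tau>"] by auto
      then have "\<tau> + 1 / real (Suc n) < u" by (simp add: inverse_eq_divide)
      then have "x \<in> B n"
        using real \<open>0 \<le> \<tau>\<close> by (simp add: B_def ennreal_less_iff del: ennreal_plus)
      then show ?thesis by blast
    next
      case top
      then have "x \<in> B 0" by (simp add: B_def)
      then show ?thesis by blast
    qed
  next
    fix x assume "x \<in> (\<Union>n. B n)"
    then obtain n where n: "ennreal (\<tau> + 1 / real (Suc n)) < U g x" by (auto simp: B_def)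
    have "ennreal \<tau> \<le> ennreal (\<tau> + 1 / real (Suc n))" by (intro ennreal_leI) simp
    also note n
    finally show "x \<in> {x. ennreal \<tau> < U g x}" by simp
  qed
  have "incseq B"
  proof (rule incseq_SucI, unfold B_def, safe)
    fix n x assume n: "ennreal (\<tau> + 1 / real (Suc n)) < U g x"
    have "ennreal (\<tau> + 1 / real (Suc (Suc n))) \<le> ennreal (\<tau> + 1 / real (Suc n))"
      by (intro ennreal_leI) (simp add: frac_le)
    also note n
    finally show "ennreal (\<tau> + 1 / real (Suc (Suc n))) < U g x" .
  qed
  moreover have "range B \<subseteq> sets lebesgue"
  proof safe
    fix n show "B n \<in> sets lebesgue"
      unfolding B_def by (rule meas) (use \<open>0 \<le> \<tau>\<close> in \<open>simp add: add_nonneg_pos\<close>)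
  qed
  ultimately have "emeasure lebesgue (\<Union>n. B n) = (SUP n. emeasure lebesgue (B n))"
    by (intro SUP_emeasure_incseq[symmetric])
  also have "\<dots> \<le> ennreal (D powr (s / ?m))"
    unfolding B_def by (intro SUP_least level) simp
  finally show ?thesis unfolding union .
qed

section \<open>Truncated tuples and the grand maximal operator\<close>

lemma restrict_tuple_restrict_tuple:
  "A \<subseteq> B \<Longrightarrow> restrict_tuple A (restrict_tuple B f) = restrict_tuple A f"
  by (auto simp: restrict_tuple_def fun_eq_iff indicator_def)

lemma restrict_tuple_in_Lp:
  assumes "\<And>i. f i \<in> Lp p" "A \<in> sets lebesgue"
  shows "restrict_tuple A f i \<in> Lp p"
  using restrict_in_Lp[OF assms(1)[of i] assms(2)] by (simp add: restrict_tuple_def)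

text \<open>
  A cube on which the essential supremum exceeds \<open>a\<close> consists of points of the superlevel set, which
  is therefore a union of open cubes.
\<close>

lemma open_grand_maximal_superlevel: "open {x. a < grand_maximal T f x}"
proof -
  have "{x. a < grand_maximal T f x} = (\<Union>(c, l) \<in> {(c, l). 0 < l \<and> a < esssup (lebesgue_on (cube c l))
      (\<lambda>\<xi>. ennreal (norm (T f \<xi> - T (restrict_tuple (cube c (3 * l)) f) \<xi>)))}. cube c l)"
    unfolding grand_maximal_def less_SUP_iff by auto
  then show ?thesis using open_cube by (auto intro!: open_UN)
qed

lemma grand_maximal_bound:
  assumes "0 < snd p" "x \<in> cub p" "grand_maximal T f x \<le> ennreal \<tau>" "0 \<le> \<tau>"
  shows "AE \<xi> in lebesgue. \<xi> \<in> cub p \<longrightarrow> norm (T f \<xi> - T (restrict_tuple (cub (triple p)) f) \<xi>) \<le> \<tau>"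
proof -
  let ?h = "\<lambda>\<xi>. ennreal (norm (T f \<xi> - T (restrict_tuple (cub (triple p)) f) \<xi>))"
  have "esssup (lebesgue_on (cub p)) ?h \<le> grand_maximal T f x"
    unfolding grand_maximal_def using assms(1,2)
    by (intro SUP_upper2[of "p"]) (auto simp: case_prod_beta)
  then have "esssup (lebesgue_on (cub p)) ?h \<le> ennreal \<tau>" using assms(3) by (rule order_trans)
  then have "AE \<xi> in lebesgue_on (cub p). ?h \<xi> \<le> ennreal \<tau>"
    using esssup_AE[of ?h "lebesgue_on (cub p)"] by (auto elim!: eventually_mono intro: order_trans)
  then show ?thesis
    using assms(4) by (subst (asm) AE_restrict_space_iff) (auto elim!: eventually_mono)
qed

text \<open>
  Used for \<open>T\<close> itself with \<open>s = q\<close> and for the maximal operator with \<open>s = r\<close>. If the threshold carries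
  the factor \<open>K\<close>, the superlevel set has measure at most \<open>|3p| / K powr (s/m)\<close>. For
  \<open>K = (8 * 9^n)^m\<close> and \<open>s \<ge> 1\<close> the denominator is at least \<open>8 * 9^n\<close>; as \<open>|3p| = 3^n * |p|\<close>, what
  remains is \<open>|p| / (8 * 3^n)\<close>.
\<close>

lemma superlevel_le_on_cube:
  fixes U :: "('m::finite \<Rightarrow> real ^ 'n::finite \<Rightarrow> 'b::euclidean_space) \<Rightarrow> real ^ 'n \<Rightarrow> ennreal"
    and f :: "'m \<Rightarrow> real ^ 'n \<Rightarrow> 'b"
  defines "g p \<equiv> restrict_tuple (cub (triple p)) f"
  assumes U: "weak_type_const s U C" and s: "1 \<le> s" "s \<le> r" and f: "\<And>i. f i \<in> Lp r"
    and p: "0 < snd p" and meas: "\<And>t. 0 < t \<Longrightarrow> {x. ennreal t < U (g p) x} \<in> sets lebesgue"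
  shows "emeasure lebesgue {x. ennreal ((8 * 9 ^ CARD('n)) ^ CARD('m) * C *
            (\<Prod>i\<in>UNIV. Lp_average r (f i) (cub (triple p)))) < U (g p) x}
          \<le> ennreal (snd p ^ CARD('n) / (8 * 3 ^ CARD('n)))"
proof -
  let ?n = "CARD('n)" and ?m = "real CARD('m)" and ?Q = "cub (triple p)"
  define P where "P = (\<Prod>i\<in>UNIV. Lp_average r (f i) ?Q)"
  define b :: real where "b = 8 * 9 ^ ?n"
  define K where "K = b ^ CARD('m)"
  define V where "V = measure lebesgue ?Q"
  have "(1::real) \<le> 9 ^ ?n" by simp
  then have b: "1 \<le> b" "0 < b" unfolding b_def by linarith+
  have K: "0 < K" using b by (simp add: K_def)
  have Q: "?Q \<in> sets lebesgue" "emeasure lebesgue ?Q < \<infinity>" and V: "V = (3 * snd p) ^ ?n" "0 < V"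
    using p by (simp_all add: emeasure_cube measure_cube V_def del: emeasure_completion)
  have C: "0 \<le> C" using U by (simp add: weak_type_const_def)
  have P: "0 \<le> P" unfolding P_def by (intro prod_nonneg) (simp add: Lp_average_nonneg)
  have "(\<Prod>i\<in>UNIV. Lp_norm s (g p i)) \<le> V powr (?m / s) * P"
    unfolding g_def P_def V_def using s Q V by (intro prod_Lp_norm_restrict_le f) (auto simp: V_def)
  then have "C * (\<Prod>i\<in>UNIV. Lp_norm s (g p i)) \<le> C * (V powr (?m / s) * P)"
    using C by (rule mult_left_mono)
  also have "\<dots> = V powr (?m / s) / K * (K * C * P)" using K by simp
  finally have le: "C * (\<Prod>i\<in>UNIV. Lp_norm s (g p i)) \<le> V powr (?m / s) / K * (K * C * P)" .
  have gLp: "g p i \<in> Lp s" for i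
    unfolding g_def restrict_tuple_def using s Q by (intro restrict_in_lower_Lp[OF f]) auto
  have level: "emeasure lebesgue {x. ennreal (K * C * P) < U (g p) x}
      \<le> ennreal ((V powr (?m / s) / K) powr (s / ?m))"
    using s C P K V(2) le by (intro weak_type_superlevel[OF U gLp _ meas]) auto
  have "(V powr (?m / s) / K) powr (s / ?m) \<le> snd p ^ ?n / (8 * 3 ^ ?n)"
  proof -
    have "(V powr (?m / s) / K) powr (s / ?m) = V / K powr (s / ?m)"
      using V(2) K s by (simp add: powr_divide powr_powr)
    also have "K powr (s / ?m) = b powr s"
      using b s by (simp add: K_def powr_realpow[symmetric] powr_powr)
    also have "V / b powr s \<le> V / b"
      using b s V powr_mono[of 1 s b] by (intro divide_left_mono) auto
    also have "V / b = snd p ^ ?n / (8 * 3 ^ ?n)"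
    proof -
      have "(9::real) ^ ?n = 3 ^ ?n * 3 ^ ?n" by (simp add: power_mult_distrib[symmetric])
      then show ?thesis by (simp add: V b_def power_mult_distrib)
    qed
    finally show ?thesis .
  qed
  then have "ennreal ((V powr (?m / s) / K) powr (s / ?m)) \<le> ennreal (snd p ^ ?n / (8 * 3 ^ ?n))"
    by (rule ennreal_leI)
  with level show ?thesis unfolding P_def K_def b_def by (rule order_trans)
qed

section \<open>Domination on a single cube\<close>

text \<open>
  The set \<open>U\<close> consists of the superlevel set \<open>E'\<close> of the maximal operator, which is open, and an open set
  \<open>G\<close> slightly larger than the superlevel set \<open>E\<close> of \<open>T\<close>. It collects three contributions of
  at most \<open>|p| / (8 * 3^n)\<close>, one each from \<open>E\<close>, \<open>G - E\<close> and \<open>E'\<close>, which stays within the budget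
  \<open>|p| / (2 * 3^n)\<close> of \<open>stopping_cubes\<close>.
\<close>

lemma local_domination:
  fixes T :: "('m::finite \<Rightarrow> real ^ 'n::finite \<Rightarrow> 'b::euclidean_space) \<Rightarrow> real ^ 'n \<Rightarrow> 'b"
    and f :: "'m \<Rightarrow> real ^ 'n \<Rightarrow> 'b"
  defines "g p \<equiv> restrict_tuple (cub (triple p)) f"
  assumes q: "1 \<le> q" "q \<le> r"
    and meas: "\<And>h. (\<And>i. h i \<in> Lp r) \<Longrightarrow> T h \<in> borel_measurable lebesgue"
    and A: "weak_type_const q (abs_op T) A" and B: "weak_type_const r (grand_maximal T) B"
    and f: "\<And>i. f i \<in> Lp r" and p: "0 < snd p"
    and \<tau>: "\<tau> = (8 * 9 ^ CARD('n)) ^ CARD('m) * (A + B) *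
              (\<Prod>i\<in>UNIV. Lp_average r (f i) (cub (triple p)))"
  shows "\<exists>N. N \<subseteq> {u. 0 < snd u} \<and> countable N \<and> disjoint_family_on cub N \<and>
    (\<forall>u\<in>N. cub u \<subseteq> cub p) \<and>
    emeasure lebesgue (\<Union>(cub ` N)) \<le> ennreal (1/2) * emeasure lebesgue (cub p) \<and>
    (AE x in lebesgue. x \<in> cub p - \<Union>(cub ` N) \<longrightarrow> norm (T (g p) x) \<le> \<tau>) \<and>
    (\<forall>u\<in>N. AE x in lebesgue. x \<in> cub u \<longrightarrow> norm (T (g p) x) \<le> \<tau> + norm (T (g u) x))"
proof -
  let ?n = "CARD('n)"
  define K :: real where "K = (8 * 9 ^ ?n) ^ CARD('m)"
  define P where "P = (\<Prod>i\<in>UNIV. Lp_average r (f i) (cub (triple p)))"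
  define \<epsilon> where "\<epsilon> = snd p ^ ?n / (8 * 3 ^ ?n)"
  define E where "E = {x. ennreal (K * A * P) < abs_op T (g p) x}"
  define E' where "E' = {x. ennreal (K * B * P) < grand_maximal T (g p) x}"
  have P: "0 \<le> P" unfolding P_def by (intro prod_nonneg) (simp add: Lp_average_nonneg)
  have K: "0 \<le> K" by (simp add: K_def)
  have AB: "0 \<le> A" "0 \<le> B" using A B by (auto simp: weak_type_const_def)
  have \<tau>1: "0 \<le> K * A * P" "K * A * P \<le> \<tau>" and \<tau>2: "0 \<le> K * B * P" "K * B * P \<le> \<tau>"
  proof -
    have "\<tau> = K * (A + B) * P" unfolding \<tau> K_def P_def by (rule refl)
    then have "\<tau> = K * A * P + K * B * P" by (simp add: algebra_simps)
    moreover show "0 \<le> K * A * P" "0 \<le> K * B * P" using P K AB by simp_all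
    ultimately show "K * A * P \<le> \<tau>" "K * B * P \<le> \<tau>" by linarith+
  qed
  have gLp: "g u i \<in> Lp r" for u i
    unfolding g_def using f by (intro restrict_tuple_in_Lp) auto
  have Tg: "T (g u) \<in> borel_measurable lebesgue" for u
    using gLp by (rule meas)
  have E_sets: "{x. ennreal t < abs_op T (g p) x} \<in> sets lebesgue" for t
  proof -
    have "(\<lambda>x. ennreal (norm (T (g p) x))) \<in> borel_measurable lebesgue"
      using Tg[of p] by measurable
    from measurable_sets[OF this, of "{ennreal t<..}"] show ?thesis
      by (simp add: abs_op_def vimage_def greaterThan_def)
  qed
  have E: "E \<in> sets lebesgue" unfolding E_def by (rule E_sets)
  have E'_open: "open {x. ennreal t < grand_maximal T (g p) x}" for t
    by (rule open_grand_maximal_superlevel)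
  have E': "open E'" unfolding E'_def by (rule E'_open)
  have \<epsilon>: "0 < \<epsilon>" using p by (simp add: \<epsilon>_def)
  have mE: "emeasure lebesgue E \<le> ennreal \<epsilon>"
    unfolding E_def \<epsilon>_def K_def P_def g_def
    using q E_sets by (intro superlevel_le_on_cube[OF A _ _ f p]) (auto simp: g_def)
  have mE': "emeasure lebesgue E' \<le> ennreal \<epsilon>"
    unfolding E'_def \<epsilon>_def K_def P_def g_def
    using q E'_open by (intro superlevel_le_on_cube[OF B _ _ f p]) (auto simp: g_def)
  obtain G where G: "open G" "E \<subseteq> G" "emeasure lebesgue (G - E) < ennreal \<epsilon>"
    using sets_lebesgue_outer_open[OF E \<epsilon>] by metis
  define U where "U = G \<union> E'"
  have U: "open U" using G E' by (auto simp: U_def)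
  have sets: "G \<in> sets lebesgue" "E' \<in> sets lebesgue" using G E' by auto
  have "emeasure lebesgue (U \<inter> cub p) \<le> emeasure lebesgue ((E \<union> (G - E)) \<union> E')"
    using E sets by (intro emeasure_mono sets.Un sets.Diff) (auto simp: U_def)
  also have "\<dots> \<le> emeasure lebesgue (E \<union> (G - E)) + emeasure lebesgue E'"
    using E sets by (intro emeasure_subadditive sets.Un sets.Diff) auto
  also have "\<dots> \<le> (emeasure lebesgue E + emeasure lebesgue (G - E)) + emeasure lebesgue E'"
    using E sets by (intro add_right_mono emeasure_subadditive) auto
  also have "\<dots> \<le> (ennreal \<epsilon> + ennreal \<epsilon>) + ennreal \<epsilon>"
    using mE mE' G(3) by (intro add_mono) auto
  also have "\<dots> = ennreal (3 * \<epsilon>)" using \<epsilon> by (simp add: ennreal_plus[symmetric] del: ennreal_plus)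
  also have "\<dots> \<le> ennreal (1 / (2 * 3 ^ ?n) * snd p ^ ?n)"
    using p by (intro ennreal_leI) (simp add: \<epsilon>_def field_simps)
  finally have small: "emeasure lebesgue (U \<inter> cub p) \<le> ennreal (1 / (2 * 3 ^ ?n) * snd p ^ ?n)" .
  obtain N where N: "N \<subseteq> {u. 0 < snd u}" "countable N" "disjoint_family_on cub N"
    "\<forall>u\<in>N. cub u \<subseteq> cub p \<and> cub (triple u) \<subseteq> cub (triple p) \<and> \<not> cub u \<subseteq> U"
    "emeasure lebesgue (\<Union>(cub ` N)) \<le> ennreal (1/2) * emeasure lebesgue (cub p)"
    "AE x in lebesgue. x \<in> cub p - \<Union>(cub ` N) \<longrightarrow> x \<notin> U"
    by (rule stopping_cubes[OF U p small]) blast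
  show ?thesis
  proof (intro exI[of _ N] conjI ballI N(1-3) N(5))
    show "cub u \<subseteq> cub p" if "u \<in> N" for u using N(4) that by blast
    have outside: "norm (T (g p) x) \<le> \<tau>" if "x \<notin> U" for x
    proof -
      have "x \<notin> E" using that G(2) by (auto simp: U_def)
      then have "norm (T (g p) x) \<le> K * A * P" using \<tau>1 by (simp add: E_def abs_op_def not_less)
      then show ?thesis using \<tau>1 by simp
    qed
    show "AE x in lebesgue. x \<in> cub p - \<Union>(cub ` N) \<longrightarrow> norm (T (g p) x) \<le> \<tau>"
      using N(6) by eventually_elim (use outside in blast)
    fix u assume u: "u \<in> N"
    \<comment> \<open>The supremum defining the maximal operator at \<open>x\<close> includes the cube \<open>u\<close>.\<close>
    then obtain x where x: "x \<in> cub u" "x \<notin> U" using N(4) by blast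
    then have "grand_maximal T (g p) x \<le> ennreal (K * B * P)" by (auto simp: U_def E'_def not_less)
    then have "AE \<xi> in lebesgue. \<xi> \<in> cub u \<longrightarrow>
        norm (T (g p) \<xi> - T (restrict_tuple (cub (triple u)) (g p)) \<xi>) \<le> K * B * P"
      using u N(1) x(1) \<tau>2 by (intro grand_maximal_bound) auto
    moreover have "restrict_tuple (cub (triple u)) (g p) = g u"
      unfolding g_def using N(4) u by (intro restrict_tuple_restrict_tuple) blast
    ultimately have "AE \<xi> in lebesgue. \<xi> \<in> cub u \<longrightarrow> norm (T (g p) \<xi> - T (g u) \<xi>) \<le> K * B * P" by simp
    then show "AE \<xi> in lebesgue. \<xi> \<in> cub u \<longrightarrow> norm (T (g p) \<xi>) \<le> \<tau> + norm (T (g u) \<xi>)"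
    proof eventually_elim
      case (elim \<xi>)
      then show ?case using \<tau>2 norm_triangle_sub[of "T (g p) \<xi>" "T (g u) \<xi>"] by auto
    qed
  qed
qed

section \<open>Sparse domination\<close>

lemma compactly_supported_in_cube:
  fixes f :: "'m::finite \<Rightarrow> real ^ 'n::finite \<Rightarrow> 'b::euclidean_space"
  assumes "\<And>i. compactly_supported (f i)"
  obtains L where "0 < L" "\<And>i x. f i x \<noteq> 0 \<Longrightarrow> x \<in> cube 0 L"
proof -
  have "bounded {x. f i x \<noteq> 0}" for i
    using assms[of i] bounded_subset[OF compact_imp_bounded closure_subset]
    by (auto simp: compactly_supported_def)
  then have "bounded (\<Union>i. {x. f i x \<noteq> 0})" by (intro bounded_UN) auto
  then obtain b where b: "0 < b" "\<And>i x. f i x \<noteq> 0 \<Longrightarrow> norm x \<le> b"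
    unfolding bounded_pos by blast
  show thesis
  proof
    show "0 < 3 * b" using b by simp
    fix i x assume "f i x \<noteq> 0"
    then have "\<bar>x $ j\<bar> < 3 * b / 2" for j
      using b(2)[of i x] component_le_norm_cart[of x j] b(1) by linarith
    then show "x \<in> cube 0 (3 * b)" by (simp add: cube_def)
  qed
qed

lemma finite_sum_le_infsum_ennreal:
  fixes h :: "'a \<Rightarrow> ennreal"
  assumes "finite B" "B \<subseteq> S"
  shows "sum h B \<le> infsum h S"
  using assms by (subst nonneg_infsum_complete) (auto intro: SUP_upper)

theorem theorem1p1:
  fixes q r :: real
  assumes "1 \<le> q" and "q \<le> r"
  shows "\<exists>c>0. \<forall>T :: ('m::finite \<Rightarrow> real ^ 'n::finite \<Rightarrow> 'b::{real_normed_field, euclidean_space})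
                        \<Rightarrow> real ^ 'n \<Rightarrow> 'b.
    (\<forall>f. (\<forall>i. f i \<in> Lp q) \<or> (\<forall>i. f i \<in> Lp r) \<longrightarrow> T f \<in> borel_measurable lebesgue) \<and>
    weak_bounded q (abs_op T) \<and>
    weak_bounded r (grand_maximal T) \<longrightarrow>
    (\<forall>f. (\<forall>i. f i \<in> Lp r \<and> compactly_supported (f i)) \<longrightarrow>
      (\<exists>S. sparse_family S \<and>
        (AE x in lebesgue.
          ennreal (norm (T f x)) \<le>
            ennreal (c * (weak_op_norm q (abs_op T) + weak_op_norm r (grand_maximal T))) *
            (\<Sum>\<^sub>\<infinity>Q\<in>S. ennreal (\<Prod>i\<in>UNIV. Lp_average r (f i) Q) * indicator Q x))))"
proof (intro exI[of _ "(8 * 9 ^ CARD('n)) ^ CARD('m)"] conjI allI impI)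
  fix T :: "('m \<Rightarrow> real ^ 'n \<Rightarrow> 'b) \<Rightarrow> real ^ 'n \<Rightarrow> 'b" and f :: "'m \<Rightarrow> real ^ 'n \<Rightarrow> 'b"
  assume hyp: "(\<forall>f. (\<forall>i. f i \<in> Lp q) \<or> (\<forall>i. f i \<in> Lp r) \<longrightarrow> T f \<in> borel_measurable lebesgue) \<and>
    weak_bounded q (abs_op T) \<and> weak_bounded r (grand_maximal T)"
    and hf: "\<forall>i. f i \<in> Lp r \<and> compactly_supported (f i)"
  let ?n = "CARD('n)"
  define c :: real where "c = (8 * 9 ^ ?n) ^ CARD('m)"
  define A where "A = weak_op_norm q (abs_op T)"
  define B where "B = weak_op_norm r (grand_maximal T)"
  define I where "I = {p :: (real ^ 'n) \<times> real. 0 < snd p}"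
  define h where "h p = cub (triple p)" for p :: "(real ^ 'n) \<times> real"
  define g where "g p = restrict_tuple (h p) f" for p
  define P where "P Q = (\<Prod>i\<in>UNIV. Lp_average r (f i) Q)" for Q
  have f: "\<And>i. f i \<in> Lp r" and supp: "\<And>i. compactly_supported (f i)" using hf by auto
  have A: "weak_type_const q (abs_op T) A" and B: "weak_type_const r (grand_maximal T) B"
    using hyp weak_op_norm_attained unfolding A_def B_def by blast+
  have AB: "0 \<le> c * (A + B)" using A B by (simp add: weak_type_const_def c_def)
  have P: "0 \<le> P Q" for Q unfolding P_def by (intro prod_nonneg) (simp add: Lp_average_nonneg)
  have meas: "T h \<in> borel_measurable lebesgue" if "\<And>i. h i \<in> Lp r" for h using hyp that by blast

  obtain L where L: "0 < L" "\<And>i x. f i x \<noteq> 0 \<Longrightarrow> x \<in> cube 0 L"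
    using compactly_supported_in_cube[of f] supp by blast
  obtain R :: "((real ^ 'n) \<times> real) set" where R0: "R \<subseteq> {p. 0 < snd p}"
    "countable R" "disjoint_family_on cub R" "AE x in lebesgue. \<exists>p\<in>R. x \<in> cub p"
    "\<forall>p\<in>R. cube 0 L \<subseteq> cub (triple p)"
    by (rule shell_cubes[OF L(1)]) blast
  note R = R0[folded I_def h_def]
  \<comment> \<open>On a root the truncation to its triple changes nothing, so the tree bounds \<open>T f\<close> itself.\<close>
  have gR: "g p = f" if "p \<in> R" for p
    using L(2) R(5) that by (fastforce simp: g_def restrict_tuple_def fun_eq_iff indicator_def)

  \<comment> \<open>The choice of stopping cubes, made at once for all cubes of positive side.\<close>
  define step where "step p N \<longleftrightarrow> N \<subseteq> I \<and> countable N \<and> disjoint_family_on cub N \<and>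
    (\<forall>u\<in>N. cub u \<subseteq> cub p) \<and>
    emeasure lebesgue (\<Union>(cub ` N)) \<le> ennreal (1/2) * emeasure lebesgue (cub p) \<and>
    (AE x in lebesgue. x \<in> cub p - \<Union>(cub ` N) \<longrightarrow> norm (T (g p) x) \<le> c * (A + B) * P (h p)) \<and>
    (\<forall>u\<in>N. AE x in lebesgue. x \<in> cub u \<longrightarrow>
        norm (T (g p) x) \<le> c * (A + B) * P (h p) + norm (T (g u) x))" for p N
  have "\<exists>N. step p N" if "p \<in> I" for p
  proof -
    have p: "0 < snd p" using that by (simp add: I_def)
    show ?thesis
      unfolding step_def g_def h_def c_def P_def I_def
      by (rule local_domination[where f = f and p = p, OF assms meas A B f p refl])
  qed
  then obtain N where step: "\<And>p. p \<in> I \<Longrightarrow> step p (N p)" by metis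
  have N: "\<And>p. p \<in> I \<Longrightarrow> N p \<subseteq> I"
    "\<And>p. p \<in> I \<Longrightarrow> countable (N p)"
    "\<And>p. p \<in> I \<Longrightarrow> disjoint_family_on cub (N p)"
    "\<And>p u. p \<in> I \<Longrightarrow> u \<in> N p \<Longrightarrow> cub u \<subseteq> cub p"
    "\<And>p. p \<in> I \<Longrightarrow> emeasure lebesgue (\<Union>(cub ` N p)) \<le> ennreal (1/2) * emeasure lebesgue (cub p)"
    "\<And>p. p \<in> I \<Longrightarrow> AE x in lebesgue. x \<in> cub p - \<Union>(cub ` N p) \<longrightarrow>
        norm (T (g p) x) \<le> c * (A + B) * P (h p)"
    "\<And>p u. p \<in> I \<Longrightarrow> u \<in> N p \<Longrightarrow> AE x in lebesgue. x \<in> cub u \<longrightarrow>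
        norm (T (g p) x) \<le> c * (A + B) * P (h p) + norm (T (g u) x)"
    using step unfolding step_def by blast+

  interpret stopping_tree lebesgue cub N R I
    using R N
    by unfold_locales (auto simp: I_def emeasure_cube simp del: emeasure_completion ennreal_half)

  define F where "F = tree"
  have F: "F \<subseteq> I" using tree_sub by (simp add: F_def)
  have inj: "inj_on h F"
    using inj_on_cub_triple inj_on_subset F unfolding h_def I_def by blast
  define S where "S = h ` F"
  \<comment> \<open>The set assigned to a tripled cube is the core of the original one.\<close>
  have "sparse_family S"
    unfolding sparse_family_def
  proof (intro conjI ballI exI[of _ "1 / (2 * 3 ^ ?n)"] exI[of _ "\<lambda>Q. core (inv_into F h Q)"])
    fix Q assume "Q \<in> S"
    then obtain p where p: "p \<in> F" "Q = h p" by (auto simp: S_def)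
    then have pI: "p \<in> I" "0 < snd p" using F by (auto simp: I_def)
    show "is_cube Q"
      using p pI by (auto simp: is_cube_def h_def intro!: exI[of _ "fst p"] exI[of _ "3 * snd p"])
    have inv: "inv_into F h Q = p" using p inj by simp
    show "core (inv_into F h Q) \<in> sets lebesgue" unfolding inv using core_sets pI by simp
    have sub: "core p \<subseteq> cub p" by (auto simp: core_def)
    then show "core (inv_into F h Q) \<subseteq> Q"
      unfolding inv unfolding p(2) h_def using cube_mono[of "snd p" "3 * snd p" "fst p"] pI by auto
    have "emeasure lebesgue (core p) \<le> emeasure lebesgue (cub p)"
      using sub by (intro emeasure_mono) auto
    also have "\<dots> < \<infinity>" using pI by (simp add: emeasure_cube del: emeasure_completion)
    finally have fin: "emeasure lebesgue (core p) = ennreal (measure lebesgue (core p))"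
      by (intro emeasure_eq_ennreal_measure) auto
    have "ennreal (snd p ^ ?n) \<le> 2 * ennreal (measure lebesgue (core p))"
      using core_large[OF pI(1)] pI fin by (simp add: emeasure_cube del: emeasure_completion)
    also have "\<dots> = ennreal (2 * measure lebesgue (core p))" by (simp add: ennreal_mult)
    finally have "snd p ^ ?n \<le> 2 * measure lebesgue (core p)" by simp
    then show "1 / (2 * 3 ^ ?n) * measure lebesgue Q \<le> measure lebesgue (core (inv_into F h Q))"
      unfolding inv unfolding p(2) h_def using pI by (simp add: measure_cube power_mult_distrib)
  next
    show "disjoint_family_on (\<lambda>Q. core (inv_into F h Q)) S"
      unfolding disjoint_family_on_def
    proof (intro ballI impI)
      fix Q Q' assume "Q \<in> S" "Q' \<in> S" "Q \<noteq> Q'"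
      then obtain p p' where "p \<in> F" "p' \<in> F" "Q = h p" "Q' = h p'" "p \<noteq> p'" by (auto simp: S_def)
      then show "core (inv_into F h Q) \<inter> core (inv_into F h Q') = {}"
        using core_disjoint inj by (simp add: disjoint_family_on_def F_def)
    qed
  next
    have "(1::real) \<le> 3 ^ ?n" by simp
    then have "1 < 2 * (3::real) ^ ?n" by linarith
    then show "1 / (2 * 3 ^ ?n) < (1::real)" by (subst divide_less_eq_1_pos) auto
  qed auto
  moreover
  have "AE x in lebesgue. \<forall>p\<in>R. x \<in> cub p \<longrightarrow>
      (\<exists>B'. finite B' \<and> B' \<subseteq> tree \<and> (\<forall>p\<in>B'. x \<in> cub p) \<and>
        ennreal (norm (T (g p) x)) \<le> (\<Sum>p\<in>B'. ennreal (c * (A + B) * P (h p))))"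
  proof (rule tree_domination)
    fix p assume p: "p \<in> I"
    show "AE x in lebesgue. x \<in> core p \<longrightarrow> ennreal (norm (T (g p) x)) \<le> ennreal (c * (A + B) * P (h p))"
      using N(6)[OF p] unfolding core_def by eventually_elim (auto intro: ennreal_leI)
    fix u assume u: "u \<in> N p"
    show "AE x in lebesgue. x \<in> cub u \<longrightarrow>
      ennreal (norm (T (g p) x)) \<le> ennreal (c * (A + B) * P (h p)) + ennreal (norm (T (g u) x))"
      using N(7)[OF p u]
    proof eventually_elim
      case (elim x)
      have "0 \<le> c * (A + B) * P (h p)" using AB P by (rule mult_nonneg_nonneg)
      then show ?case using elim by (auto simp: ennreal_plus[symmetric] simp del: ennreal_plus intro!: ennreal_leI)
    qed
  qed
  with R(4) have "AE x in lebesgue. ennreal (norm (T f x)) \<le>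
      ennreal (c * (A + B)) * (\<Sum>\<^sub>\<infinity>Q\<in>S. ennreal (P Q) * indicator Q x)"
  proof eventually_elim
    case (elim x)
    from elim(1) obtain p where p: "p \<in> R" "x \<in> cub p" by blast
    from elim(2)[rule_format, OF p] obtain B' where B': "finite B'" "B' \<subseteq> F" "\<forall>p\<in>B'. x \<in> cub p"
      and le: "ennreal (norm (T (g p) x)) \<le> (\<Sum>p\<in>B'. ennreal (c * (A + B) * P (h p)))"
      unfolding F_def by (elim exE conjE)
    have xh: "x \<in> h p" if "p \<in> B'" for p
    proof -
      have "0 < snd p" using that B' F by (auto simp: I_def)
      then show ?thesis
        using cube_mono[of "snd p" "3 * snd p" "fst p"] B'(3) that by (auto simp: h_def)
    qed
    have "(\<Sum>p\<in>B'. ennreal (c * (A + B) * P (h p)))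
        = ennreal (c * (A + B)) * (\<Sum>p\<in>B'. ennreal (P (h p)) * indicator (h p) x)"
      unfolding sum_distrib_left using AB P xh by (intro sum.cong) (auto simp: ennreal_mult)
    also have "(\<Sum>p\<in>B'. ennreal (P (h p)) * indicator (h p) x)
        = (\<Sum>Q\<in>h ` B'. ennreal (P Q) * indicator Q x)"
      using inj_on_subset[OF inj B'(2)] by (simp add: sum.reindex)
    finally have "(\<Sum>p\<in>B'. ennreal (c * (A + B) * P (h p)))
        = ennreal (c * (A + B)) * (\<Sum>Q\<in>h ` B'. ennreal (P Q) * indicator Q x)" .
    moreover have "(\<Sum>Q\<in>h ` B'. ennreal (P Q) * indicator Q x)
        \<le> (\<Sum>\<^sub>\<infinity>Q\<in>S. ennreal (P Q) * indicator Q x)"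
      using B' by (intro finite_sum_le_infsum_ennreal) (auto simp: S_def)
    ultimately have "(\<Sum>p\<in>B'. ennreal (c * (A + B) * P (h p)))
        \<le> ennreal (c * (A + B)) * (\<Sum>\<^sub>\<infinity>Q\<in>S. ennreal (P Q) * indicator Q x)"
      by (simp only: mult_left_mono zero_le)
    with le show ?case unfolding gR[OF p(1)] by (rule order_trans)
  qed
  ultimately show "\<exists>S. sparse_family S \<and>
        (AE x in lebesgue. ennreal (norm (T f x)) \<le>
            ennreal ((8 * 9 ^ CARD('n)) ^ CARD('m) *
              (weak_op_norm q (abs_op T) + weak_op_norm r (grand_maximal T))) *
            (\<Sum>\<^sub>\<infinity>Q\<in>S. ennreal (\<Prod>i\<in>UNIV. Lp_average r (f i) Q) * indicator Q x))"
    unfolding A_def B_def P_def c_def by blast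
qed simp

end
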